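(* For all $\varepsilon>0$ and integers $r\geq 2$, $k\geq 2$ there exist $\delta=\delta(\varepsilon,r)>0$, $\xi=\xi(\varepsilon,r)>0$, $L=L(\varepsilon,r,k)$ and $n_0$ such that for every graph $G$ of order $n\geq n_0$ the following holds: if $V(G)=\bigcup_{i=0}^{k}V_i$ is a $\delta$-uniform partition such that for every $i\in[k]$, \[ k_r(V_i)\leq \xi|V_i|^r\quad\text{or}\quad k_r\big(\overline{G[V_i]}\big)\leq \xi|V_i|^r, \] then there exists an $\varepsilon$-uniform partition $V(G)=\bigcup_{i=0}^{q}W_i$ with $k\leq q\leq L$ such that for every $i\in[q]$, \[ e(W_i)<\varepsilon\binom{|W_i|}{2}\quad\text{or}\quad e(W_i)>(1-\varepsilon)\binom{|W_i|}{2}. \]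
   Context: All graphs are finite and simple. $k_r(F)$ is the number of $r$-cliques of a graph $F$; $k_r(U)=k_r(G[U])$ for $U\subset V(G)$, and $\overline{G[U]}$ is the complement of the induced subgraph $G[U]$ (so $k_r(\overline{G[U]})$ counts independent $r$-sets in $G[U]$). $e(U)$ is the number of edges of $G[U]$. For disjoint nonempty $A,B\subset V(G)$, $d(A,B)=e(A,B)/(|A||B|)$ where $e(A,B)$ is the number of $A$–$B$ edges. A pair $(A,B)$ is $\varepsilon$-uniform if for all $X\subset A$, $Y\subset B$ with $|X|\geq\varepsilon|A|$, $|Y|\geq\varepsilon|B|$ one has $|d(X,Y)-d(A,B)|<\varepsilon$. A partition $V=\bigcup_{i=0}^{k}V_i$ is equitable if $|V_0|<k$ and $|V_1|=\dots=|V_k|$; it is $\varepsilon$-uniform if it is equitable and at most $\varepsilon k^2$ pairs $(V_i,V_j)$, $1\le i<j\le k$, are not $\varepsilon$-uniform. *)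

theory Defs
  imports Complex_Main "HOL-Library.Ramsey" "HOL-Library.Disjoint_Sets"
begin

text \<open>A graph is given by its vertex set and its set of two-element edges.\<close>

definition simple_graph :: "'a set \<Rightarrow> 'a set set \<Rightarrow> bool" where
  "simple_graph V E \<longleftrightarrow> finite V \<and> E \<subseteq> [V]\<^bsup>2\<^esup>"

definition induced_edges :: "'a set set \<Rightarrow> 'a set \<Rightarrow> 'a set set" where
  "induced_edges E U = {e \<in> E. e \<subseteq> U}"

definition complement_edges :: "'a set \<Rightarrow> 'a set set \<Rightarrow> 'a set set" where
  "complement_edges V E = [V]\<^bsup>2\<^esup> - E"

definition num_cliques :: "nat \<Rightarrow> 'a set \<Rightarrow> 'a set set \<Rightarrow> nat" where
  "num_cliques r V E = card {C \<in> [V]\<^bsup>r\<^esup>. clique C E}"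

text \<open>For disjoint \<open>A\<close> and \<open>B\<close> each edge between them is counted by exactly one ordered pair.\<close>

definition num_edges_between :: "'a set set \<Rightarrow> 'a set \<Rightarrow> 'a set \<Rightarrow> nat" where
  "num_edges_between E A B = card {(x, y) \<in> A \<times> B. {x, y} \<in> E}"

definition edge_density :: "'a set set \<Rightarrow> 'a set \<Rightarrow> 'a set \<Rightarrow> real" where
  "edge_density E A B = real (num_edges_between E A B) / (real (card A) * real (card B))"

definition uniform_pair :: "real \<Rightarrow> 'a set set \<Rightarrow> 'a set \<Rightarrow> 'a set \<Rightarrow> bool" where
  "uniform_pair \<epsilon> E A B \<longleftrightarrow>
     (\<forall>X Y. X \<subseteq> A \<and> Y \<subseteq> B \<and>
        real (card X) \<ge> \<epsilon> * real (card A) \<and> real (card Y) \<ge> \<epsilon> * real (card B) \<longrightarrow>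
        \<bar>edge_density E X Y - edge_density E A B\<bar> < \<epsilon>)"

text \<open>
  The parts are \<open>P 0, \<dots>, P k\<close>, with exceptional part \<open>P 0\<close>; values of \<open>P\<close> beyond \<open>k\<close> are
  irrelevant.  The parts may be empty, but \<open>P 1, \<dots>, P k\<close> are automatically nonempty once
  \<open>card V \<ge> k\<close>, because \<open>card (P 0) < k\<close>.
\<close>

definition equitable_partition :: "'a set \<Rightarrow> nat \<Rightarrow> (nat \<Rightarrow> 'a set) \<Rightarrow> bool" where
  "equitable_partition V k P \<longleftrightarrow>
     (\<Union>i\<in>{0..k}. P i) = V \<and> disjoint_family_on P {0..k} \<and>
     card (P 0) < k \<and> (\<forall>i\<in>{1..k}. \<forall>j\<in>{1..k}. card (P i) = card (P j))"

definition uniform_partition ::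
  "real \<Rightarrow> 'a set \<Rightarrow> 'a set set \<Rightarrow> nat \<Rightarrow> (nat \<Rightarrow> 'a set) \<Rightarrow> bool" where
  "uniform_partition \<epsilon> V E k P \<longleftrightarrow>
     equitable_partition V k P \<and>
     real (card {(i, j). 1 \<le> i \<and> i < j \<and> j \<le> k \<and> \<not> uniform_pair \<epsilon> E (P i) (P j)})
       \<le> \<epsilon> * (real k)\<^sup>2"

end

theory Submission
  imports Defs
begin

text \<open>
  A vertex set with few cliques of size \<open>r\<close> contains a sparse subset of linear size: pass to
  neighbourhoods and induct on \<open>r\<close>.  Extracting such subsets repeatedly and spreading the small
  remainder over them splits every \<open>V\<^sub>i\<close> into exactly \<open>m = m(\<epsilon>, r)\<close> equal parts, each sparse or,
  after passing to the complement, dense.  If \<open>k\<close> is at least \<open>2 / \<epsilon>\<close> this finishes the proof: pairs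
  of parts inside one \<open>V\<^sub>i\<close> are a negligible fraction of all pairs, and uniformity with
  \<open>\<delta> = \<epsilon> / (2 m)\<close> is inherited by pairs of parts of different \<open>V\<^sub>i\<close>.  For the finitely many
  smaller \<open>k\<close>, Szemeredi's regularity lemma first refines the given partition to one with at least
  \<open>2 / \<epsilon>\<close> parts; its number of parts is bounded in terms of \<open>\<epsilon>\<close> and \<open>r\<close>, so \<open>\<xi>\<close> can absorb the
  loss in relative clique count.
\<close>

section \<open>Sparse equipartitions of sets with few cliques\<close>

text \<open>The order of the quantifiers shapes the proof: \<delta> and \<xi> may depend on
  \<epsilon> and r only. A regularity refinement has a number of parts that grows with k, and
  passing to a subset of relative size 1 / c can multiply the relative clique count by
  \<open>c ^ r\<close>; refining is therefore affordable only while k stays below a bound in terms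
  of \<epsilon> and r. Beyond that bound the given uniformity has to do the work, and it can,
  because the number m of pieces per part never depends on k. Equitability of the result forces one
  m for all parts, whether poor in cliques or in independent sets. This is why an exact
  equipartition is needed and not merely one sparse subset. The threshold 2 / \<epsilon> comes from
  spending one half of the admissible \<epsilon> * q^2 pairs on pairs inside a single old part and
  the other half on pairs inherited from non-uniform old pairs. Regularity is needed in refining
  form because a new part inherits a small clique count only from an old part that contains
  it.\<close>

lemma num_edges_between_eq_sum:
  assumes "finite A" "finite B"
  shows "num_edges_between E A B = (\<Sum>x\<in>A. card {y \<in> B. {x, y} \<in> E})"
proof -
  have "{(x, y) \<in> A \<times> B. {x, y} \<in> E} = (SIGMA x:A. {y \<in> B. {x, y} \<in> E})" by auto
  then show ?thesis
    using assms by (simp add: num_edges_between_def)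
qed

lemma num_edges_between_le:
  assumes "finite A" "finite B"
  shows "num_edges_between E A B \<le> card A * card B"
proof -
  have "card {(x, y) \<in> A \<times> B. {x, y} \<in> E} \<le> card (A \<times> B)"
    using assms by (intro card_mono) auto
  then show ?thesis by (simp add: num_edges_between_def card_cartesian_product)
qed

lemma num_edges_between_Un_le:
  assumes "finite A" "finite B"
  shows "num_edges_between E (A \<union> B) (A \<union> B)
    \<le> num_edges_between E A A + 2 * (card B * card (A \<union> B))"
proof -
  have "{(x, y) \<in> (A \<union> B) \<times> (A \<union> B). {x, y} \<in> E}
    \<subseteq> {(x, y) \<in> A \<times> A. {x, y} \<in> E} \<union> (B \<times> (A \<union> B) \<union> (A \<union> B) \<times> B)"
    by auto
  then have "num_edges_between E (A \<union> B) (A \<union> B)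
    \<le> card ({(x, y) \<in> A \<times> A. {x, y} \<in> E} \<union> (B \<times> (A \<union> B) \<union> (A \<union> B) \<times> B))"
    unfolding num_edges_between_def
    using assms by (intro card_mono) (auto intro: finite_subset[of _ "A \<times> A"])
  also have "\<dots> \<le> num_edges_between E A A + (card (B \<times> (A \<union> B)) + card ((A \<union> B) \<times> B))"
    unfolding num_edges_between_def
    by (meson add_left_mono card_Un_le order_trans)
  finally show ?thesis by (simp add: card_cartesian_product mult.commute)
qed

text \<open>Between W and itself every edge is counted in both orders, and without loops the pair
  (x, x) is absent, so x accounts for exactly twice its degree.\<close>

lemma num_edges_between_remove:
  assumes "finite W" "x \<in> W" "{x} \<notin> E"
  shows "num_edges_between E W W
    = num_edges_between E (W - {x}) (W - {x}) + 2 * card {y \<in> W. {x, y} \<in> E}"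
proof -
  let ?N = "{y \<in> W. {x, y} \<in> E}"
  have eq: "{(u, v) \<in> W \<times> W. {u, v} \<in> E}
    = {(u, v) \<in> (W - {x}) \<times> (W - {x}). {u, v} \<in> E} \<union> ({x} \<times> ?N \<union> ?N \<times> {x})"
    using assms by (auto simp: insert_commute)
  have "finite {(u, v) \<in> (W - {x}) \<times> (W - {x}). {u, v} \<in> E}"
    by (rule finite_subset[of _ "W \<times> W"]) (use assms in auto)
  moreover have "x \<notin> ?N" using assms by auto
  then have "({x} \<times> ?N) \<inter> (?N \<times> {x}) = {}" by blast
  then have "card ({x} \<times> ?N \<union> ?N \<times> {x}) = 2 * card ?N"
    using assms by (simp add: card_Un_disjoint card_cartesian_product)
  moreover have "{(u, v) \<in> (W - {x}) \<times> (W - {x}). {u, v} \<in> E} \<inter> ({x} \<times> ?N \<union> ?N \<times> {x}) = {}"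
    by auto
  ultimately show ?thesis
    unfolding num_edges_between_def eq using assms by (simp add: card_Un_disjoint)
qed

lemma num_cliques_mono:
  assumes "finite U" "W \<subseteq> U"
  shows "num_cliques r W E \<le> num_cliques r U E"
  unfolding num_cliques_def
proof (rule card_mono)
  show "finite {C \<in> [U]\<^bsup>r\<^esup>. clique C E}"
    using assms(1) by (simp add: finite_imp_finite_nsets)
qed (use nsets_mono[OF assms(2), of r] in blast)

text \<open>Double counting of cliques with a marked vertex: v together with an r-clique in its
  neighbourhood is an (r+1)-clique marked at v, and each (r+1)-clique admits r + 1 marks.\<close>

lemma sum_num_cliques_neighbourhoods_le:
  assumes U: "finite U" and loops: "\<And>x. {x} \<notin> E"
  shows "(\<Sum>v\<in>U. num_cliques r {u \<in> U. {v, u} \<in> E} E) \<le> Suc r * num_cliques (Suc r) U E"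
proof -
  define N where "N = (\<lambda>v. {u \<in> U. {v, u} \<in> E})"
  let ?K = "\<lambda>v. {C \<in> [N v]\<^bsup>r\<^esup>. clique C E}"
  let ?L = "{D \<in> [U]\<^bsup>Suc r\<^esup>. clique D E}"
  have finN: "finite (N v)" for v using U by (simp add: N_def)
  have finK: "finite (?K v)" for v
    using finN by (simp add: finite_imp_finite_nsets)
  have finL: "finite ?L"
    using U by (simp add: finite_imp_finite_nsets)
  let ?f = "\<lambda>(v, C). (insert v C, v)"
  have inj: "inj_on ?f (SIGMA v:U. ?K v)"
  proof (rule inj_onI, clarsimp)
    fix v C D
    assume "insert v C = insert v D" "C \<in> [N v]\<^bsup>r\<^esup>" "D \<in> [N v]\<^bsup>r\<^esup>"
    moreover have "v \<notin> N v" using loops by (auto simp: N_def)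
    ultimately show "C = D" by (auto simp: nsets_def)
  qed
  have sub: "?f ` (SIGMA v:U. ?K v) \<subseteq> (SIGMA D:?L. D)"
  proof clarsimp
    fix v C
    assume v: "v \<in> U" and C: "C \<in> [N v]\<^bsup>r\<^esup>" "clique C E"
    have "v \<notin> C" using C loops by (auto simp: N_def nsets_def)
    with v C show "insert v C \<in> [U]\<^bsup>Suc r\<^esup> \<and> clique (insert v C) E"
      by (auto simp: N_def nsets_def clique_def insert_commute)
  qed
  have finLS: "finite (SIGMA D:?L. D)"
    using finL by (intro finite_SigmaI) (auto simp: nsets_def)
  have "(\<Sum>v\<in>U. num_cliques r (N v) E) = card (SIGMA v:U. ?K v)"
    using U finK by (simp add: num_cliques_def)
  also have "\<dots> \<le> card (SIGMA D:?L. D)"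
    by (rule card_inj_on_le[OF inj sub finLS])
  also have "\<dots> = (\<Sum>D\<in>?L. card D)"
    using finL by (intro card_SigmaI) (auto simp: nsets_def)
  also have "\<dots> = (\<Sum>D\<in>?L. Suc r)" by (intro sum.cong) (auto simp: nsets_def)
  also have "\<dots> = Suc r * num_cliques (Suc r) U E" by (simp add: num_cliques_def)
  finally show ?thesis by (simp add: N_def)
qed

text \<open>
  If \<open>U\<close> is not itself sparse, many vertices have linear degree, and since every clique of size
  \<open>r + 1\<close> is counted by the neighbourhoods of its vertices, one of these neighbourhoods contains
  few cliques of size \<open>r\<close>.
\<close>

lemma sparse_subset_of_few_cliques:
  fixes \<epsilon> :: real
  assumes "\<epsilon> > 0"
  shows "\<exists>\<xi>>0. \<exists>c>0. \<forall>(U :: 'a set) E. finite U \<longrightarrow> (\<forall>x. {x} \<notin> E) \<longrightarrow>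
    real (num_cliques (Suc r) U E) \<le> \<xi> * real (card U) ^ Suc r \<longrightarrow>
    (\<exists>W\<subseteq>U. c * real (card U) \<le> real (card W) \<and>
       real (num_edges_between E W W) \<le> \<epsilon> * (real (card W))\<^sup>2)"
proof (induction r)
  case 0
  \<comment> \<open>Every vertex is a 1-clique, so with \<xi> = 1/2 the hypothesis says that card U
    is at most half of itself, and U is empty.\<close>
  have "\<exists>W\<subseteq>U. 1 * real (card U) \<le> real (card W) \<and>
       real (num_edges_between E W W) \<le> \<epsilon> * (real (card W))\<^sup>2"
    if "finite U" and le: "real (num_cliques (Suc 0) U E) \<le> 1/2 * real (card U) ^ Suc 0"
    for U :: "'a set" and E
  proof -
    have "{C \<in> [U]\<^bsup>Suc 0\<^esup>. clique C E} = (\<lambda>x. {x}) ` U"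
      by (auto simp: nsets_def clique_def card_1_singleton_iff)
    then have "num_cliques (Suc 0) U E = card U"
      by (simp add: num_cliques_def card_image)
    with le have "card U = 0" by simp
    then have "U = {}" using that by simp
    then show ?thesis by (auto simp: num_edges_between_def)
  qed
  then show ?case
    by (intro exI[of _ "1/2::real"] exI[of _ "1::real"] conjI) auto
next
  case (Suc r)
  then obtain \<xi> c where \<xi>: "\<xi> > 0" and c: "c > 0"
    and IH: "\<And>(U :: 'a set) E. finite U \<Longrightarrow> (\<forall>x. {x} \<notin> E) \<Longrightarrow>
      real (num_cliques (Suc r) U E) \<le> \<xi> * real (card U) ^ Suc r \<Longrightarrow>
      \<exists>W\<subseteq>U. c * real (card U) \<le> real (card W) \<and>
        real (num_edges_between E W W) \<le> \<epsilon> * (real (card W))\<^sup>2"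
    by blast
  \<comment> \<open>If no vertex of H (defined below) had a poor neighbourhood, more than
    \<epsilon>/2 * n vertices would each see at least
    \<open>\<xi> * (\<epsilon>/2 * n) ^ Suc r\<close> cliques. Dividing by the multiplicity
    \<open>Suc (Suc r)\<close> of the double count gives this constant.\<close>
  define \<xi>' where "\<xi>' = \<xi> * (\<epsilon>/2) ^ Suc (Suc r) / real (Suc (Suc r))"
  \<comment> \<open>The 1 serves the case that U itself is sparse; otherwise the induction
    hypothesis is applied to a neighbourhood of at least \<epsilon>/2 * n vertices.\<close>
  define c' where "c' = min 1 (c * (\<epsilon>/2))"
  have "\<xi>' > 0" using \<xi> assms by (simp add: \<xi>'_def del: of_nat_Suc)
  moreover have "c' > 0" using c assms by (simp add: c'_def)
  moreover have "\<exists>W\<subseteq>U. c' * real (card U) \<le> real (card W) \<and>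
       real (num_edges_between E W W) \<le> \<epsilon> * (real (card W))\<^sup>2"
    if U: "finite U" and loops: "\<forall>x. {x} \<notin> E"
      and few: "real (num_cliques (Suc (Suc r)) U E) \<le> \<xi>' * real (card U) ^ Suc (Suc r)"
    for U :: "'a set" and E
  proof (cases "real (num_edges_between E U U) \<le> \<epsilon> * (real (card U))\<^sup>2")
    case True
    have "c' * real (card U) \<le> 1 * real (card U)"
      by (intro mult_right_mono) (auto simp: c'_def)
    with True show ?thesis by auto
  next
    case False
    define n where "n = real (card U)"
    define N where "N = (\<lambda>v. {u \<in> U. {v, u} \<in> E})"
    define H where "H = {v \<in> U. real (card (N v)) \<ge> \<epsilon> / 2 * n}"
    have HU: "H \<subseteq> U" and finH: "finite H" using U by (auto simp: H_def)
    have "U \<noteq> {}" using False by (auto simp: num_edges_between_def)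
    then have n: "n > 0" using U by (simp add: n_def card_gt_0_iff)
    have deg: "real (card (N v)) \<le> n" for v
      using U by (simp add: n_def N_def card_mono)
    have "\<epsilon> * n\<^sup>2 < real (num_edges_between E U U)"
      using False by (simp add: n_def)
    also have "\<dots> = (\<Sum>v\<in>U. real (card (N v)))"
      using U by (simp add: num_edges_between_eq_sum N_def)
    also have "\<dots> = (\<Sum>v\<in>H. real (card (N v))) + (\<Sum>v\<in>U - H. real (card (N v)))"
      using U HU by (metis add.commute sum.subset_diff)
    also have "\<dots> \<le> (\<Sum>v\<in>H. n) + (\<Sum>v\<in>U - H. \<epsilon> / 2 * n)"
      using deg by (intro add_mono sum_mono) (auto simp: H_def)
    also have "\<dots> \<le> real (card H) * n + n * (\<epsilon> / 2 * n)"
    proof -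
      have "real (card (U - H)) \<le> n" using U by (simp add: n_def card_mono)
      then have "real (card (U - H)) * (\<epsilon> / 2 * n) \<le> n * (\<epsilon> / 2 * n)"
        using n assms by (intro mult_right_mono) auto
      then show ?thesis by simp
    qed
    finally have "\<epsilon> / 2 * n * n < real (card H) * n"
      by (simp add: power2_eq_square field_simps)
    then have H: "\<epsilon> / 2 * n < real (card H)" using n by simp
    have "\<exists>v\<in>H. real (num_cliques (Suc r) (N v) E) \<le> \<xi> * real (card (N v)) ^ Suc r"
    proof (rule ccontr)
      assume *: "\<not> ?thesis"
      have gt: "real (num_cliques (Suc r) (N v) E) \<ge> \<xi> * (\<epsilon> / 2 * n) ^ Suc r"
        if "v \<in> H" for v
      proof -
        have "\<xi> * (\<epsilon> / 2 * n) ^ Suc r \<le> \<xi> * real (card (N v)) ^ Suc r"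
          using that \<xi> n assms by (intro mult_left_mono power_mono) (auto simp: H_def)
        with * that show ?thesis by fastforce
      qed
      have "\<epsilon> / 2 * n * (\<xi> * (\<epsilon> / 2 * n) ^ Suc r) < real (card H) * (\<xi> * (\<epsilon> / 2 * n) ^ Suc r)"
        using H \<xi> n assms by (intro mult_strict_right_mono) auto
      also have "\<dots> = (\<Sum>v\<in>H. \<xi> * (\<epsilon> / 2 * n) ^ Suc r)" by simp
      also have "\<dots> \<le> (\<Sum>v\<in>H. real (num_cliques (Suc r) (N v) E))"
        using gt by (intro sum_mono) auto
      also have "\<dots> \<le> (\<Sum>v\<in>U. real (num_cliques (Suc r) (N v) E))"
        using U HU by (intro sum_mono2) auto
      also have "\<dots> = real (\<Sum>v\<in>U. num_cliques (Suc r) (N v) E)" by simp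
      also have "\<dots> \<le> real (Suc (Suc r) * num_cliques (Suc (Suc r)) U E)"
        unfolding N_def using sum_num_cliques_neighbourhoods_le[OF U, of E "Suc r"] loops
        by (intro of_nat_mono) auto
      also have "\<dots> \<le> real (Suc (Suc r)) * (\<xi>' * n ^ Suc (Suc r))"
        unfolding of_nat_mult using few by (intro mult_left_mono) (auto simp: n_def)
      also have "\<dots> = \<xi> * (\<epsilon> / 2) ^ Suc (Suc r) * n ^ Suc (Suc r)"
        by (simp add: \<xi>'_def del: of_nat_Suc power_Suc)
      also have "\<dots> = \<epsilon> / 2 * n * (\<xi> * (\<epsilon> / 2 * n) ^ Suc r)"
        by (simp only: power_mult_distrib power_Suc mult_ac)
      finally show False by simp
    qed
    then obtain v where v: "v \<in> H"
      and vfew: "real (num_cliques (Suc r) (N v) E) \<le> \<xi> * real (card (N v)) ^ Suc r" by blast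
    have "finite (N v)" using U by (simp add: N_def)
    from IH[OF this loops vfew] obtain W where W: "W \<subseteq> N v"
      "c * real (card (N v)) \<le> real (card W)"
      "real (num_edges_between E W W) \<le> \<epsilon> * (real (card W))\<^sup>2" by blast
    have "c' * n \<le> c * (\<epsilon> / 2) * n" using n by (intro mult_right_mono) (auto simp: c'_def)
    also have "\<dots> = c * (\<epsilon> / 2 * n)" by simp
    also have "\<dots> \<le> c * real (card (N v))" using v c by (intro mult_left_mono) (auto simp: H_def)
    finally have "c' * real (card U) \<le> real (card W)" using W by (simp add: n_def)
    with W show ?thesis by (intro exI[of _ W]) (auto simp: N_def)
  qed
  ultimately show ?case by blast
qed

text \<open>Deleting a vertex of maximal degree preserves the bound. With n + 1 vertices and e
  ordered edges some degree is at least e / (n + 1), so at most e * (n - 1) / (n + 1) ordered edges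
  survive, and \<epsilon> * (n + 1) * (n - 1) \<le> \<epsilon> * n^2.\<close>

lemma sparse_subset_of_card:
  fixes \<epsilon> :: real
  assumes "finite W" "\<And>x. {x} \<notin> E" "s \<le> card W" "\<epsilon> \<ge> 0"
    and "real (num_edges_between E W W) \<le> \<epsilon> * (real (card W))\<^sup>2"
  shows "\<exists>S\<subseteq>W. card S = s \<and> real (num_edges_between E S S) \<le> \<epsilon> * (real s)\<^sup>2"
  using assms
proof (induction "card W - s" arbitrary: W)
  case 0
  then show ?case by (intro exI[of _ W]) auto
next
  case (Suc d)
  define n where "n = card W - 1"
  have W: "card W = Suc n" "s \<le> n" "d = n - s" using Suc by (auto simp: n_def)
  have "W \<noteq> {}" using W by auto
  define e where "e = num_edges_between E W W"
  define D where "D = (\<lambda>x. card {y \<in> W. {x, y} \<in> E})"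
  have "Max (D ` W) \<in> D ` W" using \<open>finite W\<close> \<open>W \<noteq> {}\<close> by (intro Max_in) auto
  then obtain x where "x \<in> W" "Max (D ` W) = D x" by blast
  then have x: "x \<in> W" "\<And>y. y \<in> W \<Longrightarrow> D y \<le> D x"
    using \<open>finite W\<close> by (auto simp flip: \<open>Max (D ` W) = D x\<close>)
  have "e = (\<Sum>y\<in>W. D y)"
    using Suc.prems by (simp add: e_def D_def num_edges_between_eq_sum)
  also have "\<dots> \<le> (\<Sum>y\<in>W. D x)" using x by (intro sum_mono) auto
  finally have "e \<le> Suc n * D x" using W by simp
  then have eD: "real e \<le> real (Suc n) * real (D x)"
    unfolding of_nat_mult[symmetric] by (rule of_nat_mono)
  define e' where "e' = num_edges_between E (W - {x}) (W - {x})"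
  have ee: "real e = real e' + 2 * real (D x)"
    using num_edges_between_remove[OF \<open>finite W\<close> x(1)] Suc.prems(2)
    by (simp add: e_def e'_def D_def)
  have e: "real e \<le> \<epsilon> * (real (Suc n))\<^sup>2" using Suc.prems W by (simp add: e_def)
  have "real e' \<le> \<epsilon> * (real n)\<^sup>2"
  \<comment> \<open>The estimate multiplies an inequality by n - 1, which has to be
    nonnegative.\<close>
  proof (cases "n = 0")
    case True
    then have "W = {x}" using W x by (metis card_1_singletonE singletonD One_nat_def)
    then show ?thesis by (simp add: e'_def num_edges_between_def True)
  next
    case False
    have "real e' * real (Suc n) = real e * real (Suc n) - 2 * (real (Suc n) * real (D x))"
      by (simp add: ee algebra_simps)
    also have "\<dots> \<le> real e * real (Suc n) - 2 * real e" using eD by simp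
    also have "\<dots> = real e * (real n - 1)" by (simp add: algebra_simps)
    also have "\<dots> \<le> \<epsilon> * (real (Suc n))\<^sup>2 * (real n - 1)"
      using False e by (intro mult_right_mono) auto
    also have "\<dots> = (\<epsilon> * ((real n)\<^sup>2 - 1)) * real (Suc n)"
      by (simp add: power2_eq_square algebra_simps)
    also have "\<dots> \<le> (\<epsilon> * (real n)\<^sup>2) * real (Suc n)"
      using Suc.prems by (intro mult_right_mono mult_left_mono) auto
    finally show ?thesis by (simp add: mult_le_cancel_right)
  qed
  then have "\<exists>S\<subseteq>W - {x}. card S = s \<and> real (num_edges_between E S S) \<le> \<epsilon> * (real s)\<^sup>2"
    using Suc.prems W x by (intro Suc.hyps) (auto simp: e'_def)
  then show ?case by blast
qed

section \<open>Disjoint parts of prescribed equal size\<close>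

lemma disjoint_family_on_lessThan_Suc:
  assumes "disjoint_family_on A {..<j}" "\<And>a. a < j \<Longrightarrow> A a \<inter> Z = {}"
  shows "disjoint_family_on (A(j := Z)) {..<Suc j}"
  unfolding disjoint_family_on_def
proof (intro ballI impI)
  fix a b assume "a \<in> {..<Suc j}" "b \<in> {..<Suc j}" "a \<noteq> b"
  then show "(A(j := Z)) a \<inter> (A(j := Z)) b = {}"
    using assms by (cases "a = j"; cases "b = j") (auto simp: disjoint_family_on_def Int_commute)
qed

lemma disjoint_subsets_of_card:
  assumes "finite R" "m * t \<le> card R"
  shows "\<exists>B. disjoint_family_on B {..<m} \<and> (\<forall>a<m. B a \<subseteq> R \<and> card (B a) = t)"
  using assms
proof (induction m arbitrary: R)
  case 0
  then show ?case by (auto simp: disjoint_family_on_def)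
next
  case (Suc m)
  then obtain S where S: "S \<subseteq> R" "card S = t" "finite S"
    by (metis obtain_subset_with_card_n le_add1 mult_Suc order_trans)
  have "m * t \<le> card (R - S)" using Suc S by (simp add: card_Diff_subset)
  with Suc obtain B where B: "disjoint_family_on B {..<m}" "\<forall>a<m. B a \<subseteq> R - S \<and> card (B a) = t"
    by (metis finite_Diff)
  have "disjoint_family_on (B(m := S)) {..<Suc m}"
    using B by (intro disjoint_family_on_lessThan_Suc) auto
  moreover have "\<forall>a<Suc m. (B(m := S)) a \<subseteq> R \<and> card ((B(m := S)) a) = t"
    using B S by (auto simp: less_Suc_eq)
  ultimately show ?case by blast
qed

text \<open>
  The parts are first extracted at size slightly below \<open>card U div m\<close>, so that at every stage
  a positive proportion of \<open>U\<close> is left over and still contains relatively few cliques.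
\<close>

lemma sparse_equipartition_of_few_cliques:
  fixes \<epsilon> :: real
  assumes "\<epsilon> > 0"
  shows "\<exists>\<xi>>0. \<exists>m\<ge>1. \<exists>n\<^sub>0. \<forall>(U :: 'a set) E. finite U \<longrightarrow> (\<forall>x. {x} \<notin> E) \<longrightarrow> card U \<ge> n\<^sub>0 \<longrightarrow>
    real (num_cliques (Suc r) U E) \<le> \<xi> * real (card U) ^ Suc r \<longrightarrow>
    (\<exists>W. disjoint_family_on W {..<m} \<and> (\<forall>a<m. W a \<subseteq> U \<and> card (W a) = card U div m \<and>
       real (num_edges_between E (W a) (W a)) \<le> \<epsilon> * (real (card (W a)))\<^sup>2))"
proof -
  from sparse_subset_of_few_cliques[of "\<epsilon>/4" r] assms obtain \<xi> c where
    \<xi>: "\<xi> > 0" and c: "c > 0" and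
    sparse: "\<And>(U :: 'a set) E. finite U \<Longrightarrow> (\<forall>x. {x} \<notin> E) \<Longrightarrow>
      real (num_cliques (Suc r) U E) \<le> \<xi> * real (card U) ^ Suc r \<Longrightarrow>
      \<exists>W\<subseteq>U. c * real (card U) \<le> real (card W) \<and>
        real (num_edges_between E W W) \<le> \<epsilon>/4 * (real (card W))\<^sup>2"
    by (metis divide_pos_pos zero_less_numeral)
  \<comment> \<open>Each part of final size S is a sparse core of size s = S - t filled up with t
    \<le> \<eta> * S arbitrary vertices. The filling adds at most 2 * t * S \<le> \<epsilon>/2 * S^2
    ordered edges to the at most \<epsilon>/4 * s^2 of the core.\<close>
  define \<eta> where "\<eta> = min (\<epsilon>/4) (1/2)"
  have \<eta>: "\<eta> > 0" "\<eta> \<le> \<epsilon>/4" "\<eta> \<le> 1/2" using assms by (auto simp: \<eta>_def)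
  \<comment> \<open>While cores are being extracted, at least \<eta>/2 * n vertices remain, and
    these contain a sparse set of at least c * \<eta>/2 * n vertices. The choice of m makes this at
    least n / m, which is enough for one core.\<close>
  define m where "m = nat \<lceil>2 / (c * \<eta>)\<rceil> + 1"
  have m: "m \<ge> 1" "2 / (c * \<eta>) \<le> real m" unfolding m_def by (simp, linarith)
  then have m': "1 \<le> c * (\<eta> / 2) * real m" using c \<eta> by (simp add: field_simps)
  define n\<^sub>0 where "n\<^sub>0 = nat \<lceil>4 * real m / \<eta>\<rceil>"
  \<comment> \<open>The factor \<open>(\<eta>/2) ^ Suc r\<close> in the clique bound pays for
    passing from U to what remains of it: possibly all cliques survive, but only an \<eta>/2
    fraction of the vertices is guaranteed.\<close>
  have "\<exists>W. disjoint_family_on W {..<m} \<and> (\<forall>a<m. W a \<subseteq> U \<and> card (W a) = card U div m \<and>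
       real (num_edges_between E (W a) (W a)) \<le> \<epsilon> * (real (card (W a)))\<^sup>2)"
    if U: "finite U" and loops: "\<forall>x. {x} \<notin> E" and large: "card U \<ge> n\<^sub>0"
      and few: "real (num_cliques (Suc r) U E) \<le> \<xi> * (\<eta>/2) ^ Suc r * real (card U) ^ Suc r"
    for U :: "'a set" and E
  proof -
    define n where "n = real (card U)"
    have "4 * real m / \<eta> \<le> n" using large unfolding n_def n\<^sub>0_def by linarith
    then have n: "4 * real m \<le> \<eta> * n" using \<eta> by (simp add: field_simps)
    define S where "S = card U div m"
    define t where "t = nat \<lfloor>\<eta> * real S\<rfloor>"
    define s where "s = S - t"
    have t: "real t \<le> \<eta> * real S" "real t \<ge> \<eta> * real S - 1"
      using \<eta> by (auto simp: t_def)
    have "\<eta> * real S \<le> 1 * real S" using \<eta> by (intro mult_right_mono) auto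
    then have tS: "t \<le> S" using t by linarith
    have mS: "m * S \<le> card U" by (simp add: S_def)
    have mSn: "real m * real S \<ge> n - real m"
    proof -
      have "card U = m * S + card U mod m" "card U mod m < m"
        using m by (simp_all add: S_def)
      then have "card U \<le> m * S + m" by linarith
      then have "real (card U) \<le> real (m * S + m)" by (rule of_nat_mono)
      then show ?thesis by (simp add: n_def)
    qed
    \<comment> \<open>The roundings in S and in t cost at most m each, and 4 * m \<le> \<eta> * n
      absorbs both.\<close>
    have mt: "\<eta> / 2 * n \<le> real (m * t)"
    proof -
      have "\<eta> * (n - real m) \<le> \<eta> * (real m * real S)" using mSn \<eta> by (intro mult_left_mono) auto
      moreover have "real m * (\<eta> * real S - 1) \<le> real m * real t"
        using t by (intro mult_left_mono) auto
      moreover have "\<eta> * real m \<le> 1 * real m" using \<eta> by (intro mult_right_mono) auto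
      ultimately show ?thesis using n by (simp add: algebra_simps)
    qed
    have "\<exists>A. disjoint_family_on A {..<j} \<and> (\<forall>a<j. A a \<subseteq> U \<and> card (A a) = s \<and>
       real (num_edges_between E (A a) (A a)) \<le> \<epsilon>/4 * (real s)\<^sup>2)" if "j \<le> m" for j
      using that
    proof (induction j)
      case 0
      then show ?case by (auto simp: disjoint_family_on_def)
    next
      case (Suc j)
      then obtain A where A: "disjoint_family_on A {..<j}"
        "\<forall>a<j. A a \<subseteq> U \<and> card (A a) = s \<and>
           real (num_edges_between E (A a) (A a)) \<le> \<epsilon>/4 * (real s)\<^sup>2" by auto
      define R where "R = U - (\<Union>a<j. A a)"
      have finA: "finite (A a)" if "a < j" for a using A that U finite_subset by blast
      have "card (\<Union>a<j. A a) = (\<Sum>a<j. card (A a))"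
        using A finA by (intro card_UN_disjoint) (auto simp: disjoint_family_on_def)
      also have "\<dots> = j * s" using A by simp
      finally have "card R = card U - j * s"
        using A finA by (subst R_def, subst card_Diff_subset) auto
      moreover have "j * s + m * t \<le> m * S"
      proof -
        have "j * s + m * t \<le> m * s + m * t" using Suc.prems by simp
        then show ?thesis using tS by (simp add: s_def flip: distrib_left)
      qed
      ultimately have R: "m * t \<le> card R" using mS by linarith
      have finR: "finite R" using U by (simp add: R_def)
      have R': "\<eta> / 2 * n \<le> real (card R)" using mt R by linarith
      have "real (num_cliques (Suc r) R E) \<le> real (num_cliques (Suc r) U E)"
        using U by (intro of_nat_mono num_cliques_mono) (auto simp: R_def)
      also have "\<dots> \<le> \<xi> * (\<eta>/2 * n) ^ Suc r"
        using few unfolding n_def power_mult_distrib by (simp add: mult.assoc)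
      also have "\<dots> \<le> \<xi> * real (card R) ^ Suc r"
        using R' \<xi> \<eta> by (intro mult_left_mono power_mono) (auto simp: n_def)
      finally obtain W where W: "W \<subseteq> R" "c * real (card R) \<le> real (card W)"
        "real (num_edges_between E W W) \<le> \<epsilon>/4 * (real (card W))\<^sup>2"
        using sparse[OF finR loops] by blast
      have "s \<le> card W"
      proof -
        have "real s \<le> real S" by (simp add: s_def)
        also have "\<dots> \<le> (c * (\<eta> / 2) * real m) * real S"
          using m' by (metis mult.commute mult_left_mono mult.right_neutral of_nat_0_le_iff)
        also have "\<dots> = c * (\<eta> / 2 * real (m * S))" by simp
        also have "\<dots> \<le> c * (\<eta> / 2 * n)"
          using of_nat_mono[OF mS, where 'a = real] c \<eta> unfolding n_def
          by (intro mult_left_mono) auto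
        also have "\<dots> \<le> c * real (card R)" using R' c by (intro mult_left_mono) auto
        finally show ?thesis using W by linarith
      qed
      then obtain Z where Z: "Z \<subseteq> W" "card Z = s"
        "real (num_edges_between E Z Z) \<le> \<epsilon>/4 * (real s)\<^sup>2"
        using sparse_subset_of_card[of W E s "\<epsilon>/4"] W finR finite_subset loops assms by auto
      have "Z \<subseteq> U" "\<forall>a<j. A a \<inter> Z = {}" using Z W by (auto simp: R_def)
      then have "disjoint_family_on (A(j := Z)) {..<Suc j}"
        using A by (intro disjoint_family_on_lessThan_Suc) auto
      moreover have "\<forall>a<Suc j. (A(j := Z)) a \<subseteq> U \<and> card ((A(j := Z)) a) = s \<and>
           real (num_edges_between E ((A(j := Z)) a) ((A(j := Z)) a)) \<le> \<epsilon>/4 * (real s)\<^sup>2"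
        using A Z \<open>Z \<subseteq> U\<close> by (auto simp: less_Suc_eq)
      ultimately show ?case by blast
    qed
    then obtain A where A: "disjoint_family_on A {..<m}"
      "\<forall>a<m. A a \<subseteq> U \<and> card (A a) = s \<and>
         real (num_edges_between E (A a) (A a)) \<le> \<epsilon>/4 * (real s)\<^sup>2" by blast
    define R where "R = U - (\<Union>a<m. A a)"
    have finA: "finite (A a)" if "a < m" for a using A that U finite_subset by blast
    have "card (\<Union>a<m. A a) = (\<Sum>a<m. card (A a))"
      using A finA by (intro card_UN_disjoint) (auto simp: disjoint_family_on_def)
    also have "\<dots> = m * s" using A by simp
    finally have "card R = card U - m * s"
      using A finA by (subst R_def, subst card_Diff_subset) auto
    moreover have "m * s + m * t \<le> card U" using mS tS by (simp add: s_def flip: distrib_left)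
    ultimately have "m * t \<le> card R" by linarith
    moreover have finR: "finite R" using U by (simp add: R_def)
    ultimately obtain B where B: "disjoint_family_on B {..<m}" "\<forall>a<m. B a \<subseteq> R \<and> card (B a) = t"
      using disjoint_subsets_of_card by blast
    define W where "W = (\<lambda>a. A a \<union> B a)"
    have AB: "A a \<inter> B b = {}" if "a < m" "b < m" for a b
      using B that by (auto simp: R_def)
    have "disjoint_family_on W {..<m}"
      unfolding disjoint_family_on_def
    proof (intro ballI impI)
      fix a b assume "a \<in> {..<m}" "b \<in> {..<m}" "a \<noteq> b"
      then have "A a \<inter> A b = {}" "B a \<inter> B b = {}" "A a \<inter> B b = {}" "A b \<inter> B a = {}"
        using A B AB by (auto simp: disjoint_family_on_def)
      then show "W a \<inter> W b = {}" unfolding W_def by blast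
    qed
    moreover have "W a \<subseteq> U \<and> card (W a) = S \<and>
       real (num_edges_between E (W a) (W a)) \<le> \<epsilon> * (real S)\<^sup>2" if a: "a < m" for a
    proof (intro conjI)
      show "W a \<subseteq> U" using A B a by (auto simp: W_def R_def)
      have finB: "finite (B a)" using B a finR finite_subset by blast
      show card: "card (W a) = S"
        using A B AB a finA finB tS by (simp add: W_def card_Un_disjoint s_def)
      have "real (num_edges_between E (W a) (W a))
        \<le> real (num_edges_between E (A a) (A a) + 2 * (t * S))"
        using num_edges_between_Un_le[OF finA[OF a] finB, of E] B a card
        by (intro of_nat_mono) (simp add: W_def)
      also have "\<dots> \<le> \<epsilon>/4 * (real s)\<^sup>2 + 2 * (real t * real S)" using A a by simp
      also have "\<dots> \<le> \<epsilon>/4 * (real S)\<^sup>2 + 2 * ((\<epsilon>/4 * real S) * real S)"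
      proof (intro add_mono mult_left_mono mult_right_mono power_mono)
        have "\<eta> * real S \<le> \<epsilon>/4 * real S" using \<eta> by (intro mult_right_mono) auto
        then show "real t \<le> \<epsilon>/4 * real S" using t by linarith
      qed (use assms in \<open>auto simp: s_def\<close>)
      also have "\<dots> \<le> \<epsilon> * (real S)\<^sup>2" using assms by (simp add: power2_eq_square)
      finally show "real (num_edges_between E (W a) (W a)) \<le> \<epsilon> * (real S)\<^sup>2" .
    qed
    ultimately show ?thesis by (intro exI[of _ W]) (auto simp: S_def)
  qed
  moreover have "\<xi> * (\<eta>/2) ^ Suc r > 0" using \<xi> \<eta> by simp
  ultimately show ?thesis using m by blast
qed

section \<open>Subdivisions of equitable partitions\<close>

lemma equitable_partition_card:
  assumes "finite V" "equitable_partition V k P" "i \<in> {1..k}"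
  shows "card V = card (P 0) + k * card (P i)"
proof -
  have V: "(\<Union>i\<in>{0..k}. P i) = V" and d: "disjoint_family_on P {0..k}"
    and eq: "\<forall>j\<in>{1..k}. card (P j) = card (P i)"
    using assms unfolding equitable_partition_def by blast+
  have "card V = (\<Sum>j\<in>{0..k}. card (P j))"
    unfolding V[symmetric]
    using assms(1) d V by (intro card_UN_disjoint) (auto simp: disjoint_family_on_def)
  also have "{0..k} = insert 0 {1..k}" by auto
  also have "(\<Sum>j\<in>insert 0 {1..k}. card (P j)) = card (P 0) + (\<Sum>j\<in>{1..k}. card (P j))"
    by simp
  also have "(\<Sum>j\<in>{1..k}. card (P j)) = (\<Sum>j\<in>{1..k}. card (P i))"
    using eq by (intro sum.cong) auto
  finally show ?thesis by simp
qed

text \<open>The double index (i, a) is flattened into consecutive blocks of length m. Positive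
  indices are shifted by one because index 0 is reserved for the exceptional part, which takes the
  old exceptional part together with everything the pieces leave uncovered.\<close>

definition subdivision ::
  "'a set \<Rightarrow> nat \<Rightarrow> nat \<Rightarrow> (nat \<Rightarrow> nat \<Rightarrow> 'a set) \<Rightarrow> nat \<Rightarrow> 'a set" where
  "subdivision V k m W j =
     (if j = 0 then V - (\<Union>i\<in>{1..k}. \<Union>a<m. W i a) else W ((j - 1) div m + 1) ((j - 1) mod m))"

lemma subdivision_index:
  fixes j k m :: nat
  assumes "j \<in> {1..k * m}"
  shows "(j - 1) div m + 1 \<in> {1..k}" "(j - 1) mod m < m"
proof -
  have "m > 0" using assms by (cases m) auto
  moreover have "j - 1 < k * m" using assms by auto
  ultimately show "(j - 1) div m + 1 \<in> {1..k}" "(j - 1) mod m < m"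
    using less_mult_imp_div_less[of "j - 1" k m] by auto
qed

lemma subdivision_index_exists:
  assumes "i \<in> {1..k}" "a < m"
  shows "(i - 1) * m + a + 1 \<in> {1..k * m}" "subdivision V k m W ((i - 1) * m + a + 1) = W i a"
proof -
  have "(i - 1) * m + a < (i - 1) * m + m" using assms by simp
  also have "\<dots> = i * m" using assms by (cases i) auto
  also have "\<dots> \<le> k * m" using assms by simp
  finally show "(i - 1) * m + a + 1 \<in> {1..k * m}" by simp
  show "subdivision V k m W ((i - 1) * m + a + 1) = W i a"
    using assms by (simp add: subdivision_def)
qed

lemma subdivision_image:
  "subdivision V k m W ` {1..k * m} = (\<Union>i\<in>{1..k}. W i ` {..<m})"
proof (intro equalityI subsetI)
  fix X assume "X \<in> subdivision V k m W ` {1..k * m}"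
  then obtain j where j: "j \<in> {1..k * m}" "X = subdivision V k m W j" by blast
  then have "X = W ((j - 1) div m + 1) ((j - 1) mod m)" by (auto simp: subdivision_def)
  then show "X \<in> (\<Union>i\<in>{1..k}. W i ` {..<m})" using subdivision_index[OF j(1)] by blast
next
  fix X assume "X \<in> (\<Union>i\<in>{1..k}. W i ` {..<m})"
  then obtain i a where "i \<in> {1..k}" "a < m" "X = W i a" by auto
  then show "X \<in> subdivision V k m W ` {1..k * m}"
    using subdivision_index_exists[of i k a m] by (metis imageI)
qed

text \<open>The point is the size of the new exceptional part. It consists of \<open>P 0\<close>,
  with at most k - 1 vertices, and a remainder of at most m - 1 vertices from each of the k parts:
  together at most k - 1 + k * (m - 1) < k * m.\<close>

lemma equitable_partition_subdivision:
  assumes V: "finite V" and P: "equitable_partition V k P" and k: "k \<ge> 1"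
    and W: "\<And>i a. i \<in> {1..k} \<Longrightarrow> a < m \<Longrightarrow> W i a \<subseteq> P i \<and> card (W i a) = card (P i) div m"
    and disj: "\<And>i. i \<in> {1..k} \<Longrightarrow> disjoint_family_on (W i) {..<m}"
    and m: "m \<ge> 1"
  shows "equitable_partition V (k * m) (subdivision V k m W)"
proof -
  let ?S = "subdivision V k m W"
  let ?U = "\<Union>i\<in>{1..k}. \<Union>a<m. W i a"
  have PV: "P i \<subseteq> V" if "i \<in> {0..k}" for i using P that unfolding equitable_partition_def by blast
  have eqc: "card (P i) = card (P 1)" if "i \<in> {1..k}" for i
  proof -
    have "1 \<in> {1..k}" using k by simp
    with that P show ?thesis unfolding equitable_partition_def by blast
  qed
  have UV: "?U \<subseteq> V"
  proof (intro UN_least)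
    fix i a assume "i \<in> {1..k}" "a \<in> {..<m}"
    then show "W i a \<subseteq> V" using W[of i a] PV[of i] by auto
  qed
  have U_eq: "?U = \<Union>(?S ` {1..k * m})" unfolding subdivision_image by blast
  have S0: "?S 0 = V - ?U" by (simp add: subdivision_def)
  have split: "{0..k * m} = insert 0 {1..k * m}" by auto
  have cover: "(\<Union>i\<in>{0..k * m}. ?S i) = V"
    unfolding split using UV S0 U_eq by auto
  have WW: "W i a \<inter> W i' a' = {}"
    if "i \<in> {1..k}" "i' \<in> {1..k}" "a < m" "a' < m" "(i, a) \<noteq> (i', a')" for i i' a a'
  proof (cases "i = i'")
    case True
    then show ?thesis using disj that by (auto simp: disjoint_family_on_def)
  next
    case False
    moreover have "disjoint_family_on P {0..k}" using P by (simp only: equitable_partition_def)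
    ultimately have "P i \<inter> P i' = {}" using that by (auto simp: disjoint_family_on_def)
    then show ?thesis using W that by blast
  qed
  have Spos: "?S j \<inter> ?S j' = {}" if j: "j \<in> {1..k * m}" "j' \<in> {1..k * m}" "j \<noteq> j'" for j j'
  proof -
    have "((j - 1) div m + 1, (j - 1) mod m) \<noteq> ((j' - 1) div m + 1, (j' - 1) mod m)"
    proof
      assume "((j - 1) div m + 1, (j - 1) mod m) = ((j' - 1) div m + 1, (j' - 1) mod m)"
      then have "j - 1 = j' - 1" by (metis add_right_cancel div_mult_mod_eq fst_conv snd_conv)
      then show False using j by auto
    qed
    then show ?thesis
      using WW[OF subdivision_index(1)[OF j(1)] subdivision_index(1)[OF j(2)]
          subdivision_index(2)[OF j(1)] subdivision_index(2)[OF j(2)]] j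
      by (simp add: subdivision_def)
  qed
  have disjS: "disjoint_family_on ?S {0..k * m}"
    unfolding disjoint_family_on_def
  proof (intro ballI impI)
    fix j j' assume jj: "j \<in> {0..k * m}" "j' \<in> {0..k * m}" "j \<noteq> j'"
    have z: "?S 0 \<inter> ?S l = {}" "?S l \<inter> ?S 0 = {}" if "l \<in> {1..k * m}" for l
      using that unfolding S0 U_eq by blast+
    consider "j = 0" "j' \<in> {1..k * m}" | "j' = 0" "j \<in> {1..k * m}"
      | "j \<in> {1..k * m}" "j' \<in> {1..k * m}" using jj by fastforce
    then show "?S j \<inter> ?S j' = {}"
      using z Spos jj(3) by cases simp_all
  qed
  define N where "N = card (P 1)"
  have cW: "card (?S j) = N div m" if "j \<in> {1..k * m}" for j
    using W[OF subdivision_index[OF that]] eqc[OF subdivision_index(1)[OF that]] that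
    by (simp add: subdivision_def N_def)
  have "card ?U = (\<Sum>j\<in>{1..k * m}. card (?S j))"
    unfolding U_eq
  proof (rule card_UN_disjoint)
    show "\<forall>j\<in>{1..k * m}. finite (?S j)"
      using UV V unfolding U_eq by (meson UN_upper finite_subset)
  qed (use Spos in auto)
  also have "\<dots> = k * m * (N div m)" using cW by simp
  finally have cU: "card ?U = k * m * (N div m)" .
  have "card (?S 0) = card V - k * m * (N div m)"
    unfolding S0 using UV V cU by (simp add: card_Diff_subset finite_subset)
  moreover have "card V = card (P 0) + k * N"
    using equitable_partition_card[OF V P, of 1] k by (simp add: N_def)
  moreover have "k * N = k * m * (N div m) + k * (N mod m)"
    by (metis div_mult_mod_eq distrib_left mult.assoc mult.commute)
  moreover have "card (P 0) < k" using P by (simp only: equitable_partition_def)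
  moreover have "k * (N mod m) + k \<le> k * m"
  proof -
    have "N mod m + 1 \<le> m" using m by (simp add: Suc_leI)
    then have "k * (N mod m + 1) \<le> k * m" by (rule mult_le_mono2)
    then show ?thesis by (simp add: algebra_simps)
  qed
  ultimately have "card (?S 0) < k * m" by linarith
  then show ?thesis unfolding equitable_partition_def using cover disjS cW by simp
qed

lemma equitable_partition_refine:
  assumes V: "finite V" and P: "equitable_partition V k P" and "k \<ge> 1" "m \<ge> 1"
  shows "\<exists>W. equitable_partition V (k * m) W \<and> (\<forall>j\<in>{1..k * m}. \<exists>i\<in>{1..k}. W j \<subseteq> P i)"
proof -
  have "\<forall>i\<in>{1..k}. \<exists>B. disjoint_family_on B {..<m} \<and>
      (\<forall>a<m. B a \<subseteq> P i \<and> card (B a) = card (P i) div m)"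
  proof
    fix i assume "i \<in> {1..k}"
    then have "P i \<subseteq> V" using P unfolding equitable_partition_def by fastforce
    then show "\<exists>B. disjoint_family_on B {..<m} \<and>
      (\<forall>a<m. B a \<subseteq> P i \<and> card (B a) = card (P i) div m)"
      using V finite_subset by (intro disjoint_subsets_of_card) auto
  qed
  then obtain B where B: "\<forall>i\<in>{1..k}. disjoint_family_on (B i) {..<m} \<and>
      (\<forall>a<m. B i a \<subseteq> P i \<and> card (B i a) = card (P i) div m)" by metis
  have "equitable_partition V (k * m) (subdivision V k m B)"
    using assms B by (intro equitable_partition_subdivision[of V k P]) auto
  moreover have "\<exists>i\<in>{1..k}. subdivision V k m B j \<subseteq> P i" if "j \<in> {1..k * m}" for j
    using B subdivision_index[OF that] that by (force simp: subdivision_def)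
  ultimately show ?thesis by blast
qed

section \<open>Energy and the regularity lemma\<close>

text \<open>This is the squared density weighted by card A * card B. Division by zero gives the
  value 0 when a set is empty.\<close>

definition pair_energy :: "'a set set \<Rightarrow> 'a set \<Rightarrow> 'a set \<Rightarrow> real" where
  "pair_energy E A B = (real (num_edges_between E A B))\<^sup>2 / (real (card A) * real (card B))"

text \<open>The mean square density, not normalised by the square of the number of vertices. The sum
  runs over ordered pairs; with both families equal it includes the diagonal.\<close>

definition energy :: "'a set set \<Rightarrow> 'a set set \<Rightarrow> 'a set set \<Rightarrow> real" where
  "energy E \<A> \<B> = (\<Sum>A\<in>\<A>. \<Sum>B\<in>\<B>. pair_energy E A B)"

lemma pair_energy_nonneg: "pair_energy E A B \<ge> 0"
  by (simp add: pair_energy_def)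

lemma energy_nonneg: "energy E \<A> \<B> \<ge> 0"
  by (simp add: energy_def pair_energy_nonneg sum_nonneg)

lemma pair_energy_le:
  assumes "finite A" "finite B"
  shows "pair_energy E A B \<le> real (card A) * real (card B)"
proof (cases "card A * card B = 0")
  case False
  have "real (num_edges_between E A B) \<le> real (card A) * real (card B)"
    unfolding of_nat_mult[symmetric] using assms by (intro of_nat_mono num_edges_between_le)
  then have "(real (num_edges_between E A B))\<^sup>2 \<le> (real (card A) * real (card B))\<^sup>2"
    by (intro power_mono) auto
  moreover have "real (card A) * real (card B) > 0" using False by auto
  ultimately show ?thesis by (simp add: pair_energy_def power2_eq_square divide_le_eq)
qed (auto simp: pair_energy_def)

lemma energy_le:
  assumes "finite \<A>" "finite \<B>" "disjoint \<A>" "disjoint \<B>" "finite (\<Union>\<A>)" "finite (\<Union>\<B>)"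
  shows "energy E \<A> \<B> \<le> real (card (\<Union>\<A>)) * real (card (\<Union>\<B>))"
proof -
  have fin: "finite A" if "A \<in> \<A> \<or> A \<in> \<B>" for A
    using assms that by (meson Union_upper finite_subset)
  have "energy E \<A> \<B> \<le> (\<Sum>A\<in>\<A>. \<Sum>B\<in>\<B>. real (card A) * real (card B))"
    unfolding energy_def using fin by (intro sum_mono pair_energy_le) auto
  also have "\<dots> = real (\<Sum>A\<in>\<A>. card A) * real (\<Sum>B\<in>\<B>. card B)"
    by (simp add: sum_product)
  also have "\<dots> = real (card (\<Union>\<A>)) * real (card (\<Union>\<B>))"
    using assms fin by (simp add: card_Union_disjoint disjoint_def pairwise_def disjnt_def)
  finally show ?thesis .
qed

text \<open>Members common to both families contribute to both energies, and a pair involving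
  another member of \<open>\<A>\<close> contributes at most the product of its sizes. This lets a
  refinement with cells of unequal size be replaced by an equitable one that shares most of its
  cells.\<close>

lemma energy_le_add_uncovered:
  assumes \<A>: "finite \<A>" "disjoint \<A>" "\<Union>\<A> \<subseteq> V" and V: "finite V" and \<C>: "finite \<C>"
  shows "energy E \<A> \<A> \<le> energy E \<C> \<C> + 2 * real (card (\<Union>(\<A> - \<C>))) * real (card V)"
proof -
  have sub: "energy E \<B> \<D> \<le> real (card (\<Union>\<B>)) * real (card (\<Union>\<D>))"
    if "\<B> \<subseteq> \<A>" "\<D> \<subseteq> \<A>" for \<B> \<D>
  proof (rule energy_le)
    show "finite \<B>" "finite \<D>" using that \<A> finite_subset by blast+
    show "disjoint \<B>" "disjoint \<D>" using that \<A> by (auto intro: pairwise_subset)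
    show "finite (\<Union>\<B>)" "finite (\<Union>\<D>)" using that \<A> V by (meson Union_mono finite_subset)+
  qed
  have cV: "real (card (\<Union>\<B>)) \<le> real (card V)" if "\<B> \<subseteq> \<A>" for \<B>
    using that \<A> V by (intro of_nat_mono card_mono) auto
  have "energy E \<A> \<A> = energy E (\<A> \<inter> \<C>) \<A> + energy E (\<A> - \<C>) \<A>"
    unfolding energy_def by (rule sum.Int_Diff[OF \<A>(1)])
  also have "energy E (\<A> \<inter> \<C>) \<A> = energy E (\<A> \<inter> \<C>) (\<A> \<inter> \<C>) + energy E (\<A> \<inter> \<C>) (\<A> - \<C>)"
    unfolding energy_def by (simp add: sum.Int_Diff[OF \<A>(1), of _ \<C>] sum.distrib)
  also have "energy E (\<A> \<inter> \<C>) (\<A> \<inter> \<C>) \<le> energy E \<C> \<C>"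
  proof -
    have "energy E (\<A> \<inter> \<C>) (\<A> \<inter> \<C>) \<le> (\<Sum>A\<in>\<A> \<inter> \<C>. \<Sum>B\<in>\<C>. pair_energy E A B)"
      unfolding energy_def using \<C> by (intro sum_mono sum_mono2) (auto simp: pair_energy_nonneg)
    also have "\<dots> \<le> energy E \<C> \<C>"
      unfolding energy_def using \<C>
      by (intro sum_mono2) (auto simp: pair_energy_nonneg sum_nonneg)
    finally show ?thesis .
  qed
  also have "energy E (\<A> \<inter> \<C>) (\<A> - \<C>) \<le> real (card V) * real (card (\<Union>(\<A> - \<C>)))"
    by (rule order_trans[OF sub mult_right_mono[OF cV]]) auto
  also have "energy E (\<A> - \<C>) \<A> \<le> real (card (\<Union>(\<A> - \<C>))) * real (card V)"
    by (rule order_trans[OF sub mult_left_mono[OF cV]]) auto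
  finally show ?thesis by (simp add: algebra_simps)
qed

text \<open>Cauchy-Schwarz in quotient form: the difference of the two sides is the weighted
  variance of f / w about its mean F / w'.\<close>

lemma sum_squared_div_le:
  fixes f w :: "'b \<Rightarrow> real"
  assumes "finite S" "\<And>p. p \<in> S \<Longrightarrow> w p > 0"
  shows "(\<Sum>p\<in>S. f p)\<^sup>2 / (\<Sum>p\<in>S. w p) \<le> (\<Sum>p\<in>S. (f p)\<^sup>2 / w p)"
proof (cases "S = {}")
  case False
  define F where "F = (\<Sum>p\<in>S. f p)"
  define w' where "w' = (\<Sum>p\<in>S. w p)"
  have w': "w' > 0" unfolding w'_def using assms False by (intro sum_pos) auto
  have "0 \<le> (\<Sum>p\<in>S. (f p - F / w' * w p)\<^sup>2 / w p)"
    using assms by (intro sum_nonneg divide_nonneg_pos) auto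
  also have "\<dots> = (\<Sum>p\<in>S. (f p)\<^sup>2 / w p - 2 * (F / w') * f p + (F / w')\<^sup>2 * w p)"
  proof (intro sum.cong refl)
    fix p assume "p \<in> S"
    then have "w p \<noteq> 0" using assms by force
    then show "(f p - F / w' * w p)\<^sup>2 / w p = (f p)\<^sup>2 / w p - 2 * (F / w') * f p + (F / w')\<^sup>2 * w p"
      by (simp add: power2_diff add_divide_distrib diff_divide_distrib power_mult_distrib)
         (simp add: power2_eq_square mult_ac)
  qed
  also have "\<dots> = (\<Sum>p\<in>S. (f p)\<^sup>2 / w p) - 2 * (F / w') * F + (F / w')\<^sup>2 * w'"
    by (simp only: sum.distrib sum_subtractf sum_distrib_left[symmetric]
        F_def[symmetric] w'_def[symmetric])
  also have "\<dots> = (\<Sum>p\<in>S. (f p)\<^sup>2 / w p) - F\<^sup>2 / w'"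
    using w' by (simp add: power2_eq_square)
  finally show ?thesis by (simp add: F_def w'_def)
qed simp

lemma num_edges_between_Union:
  assumes "finite \<A>" "finite \<B>" "disjoint \<A>" "disjoint \<B>" "finite (\<Union>\<A>)" "finite (\<Union>\<B>)"
  shows "num_edges_between E (\<Union>\<A>) (\<Union>\<B>)
    = (\<Sum>(C, D)\<in>\<A> \<times> \<B>. num_edges_between E C D)"
proof -
  let ?e = "\<lambda>(C, D). {(x, y) \<in> C \<times> D. {x, y} \<in> E}"
  have "{(x, y) \<in> \<Union>\<A> \<times> \<Union>\<B>. {x, y} \<in> E} = (\<Union>p\<in>\<A> \<times> \<B>. ?e p)" by fastforce
  moreover have "card (\<Union>p\<in>\<A> \<times> \<B>. ?e p) = (\<Sum>p\<in>\<A> \<times> \<B>. card (?e p))"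
  proof (rule card_UN_disjoint)
    show "finite (\<A> \<times> \<B>)" using assms by simp
    show "\<forall>p\<in>\<A> \<times> \<B>. finite (?e p)"
    proof
      fix p assume "p \<in> \<A> \<times> \<B>"
      then have "?e p \<subseteq> \<Union>\<A> \<times> \<Union>\<B>" by auto
      then show "finite (?e p)" using assms finite_subset by blast
    qed
    show "\<forall>p\<in>\<A> \<times> \<B>. \<forall>p'\<in>\<A> \<times> \<B>. p \<noteq> p' \<longrightarrow> ?e p \<inter> ?e p' = {}"
    proof (intro ballI impI)
      fix p p' assume p: "p \<in> \<A> \<times> \<B>" "p' \<in> \<A> \<times> \<B>" "p \<noteq> p'"
      obtain C D C' D' where CD: "p = (C, D)" "p' = (C', D')" by fastforce
      then have "C \<inter> C' = {} \<or> D \<inter> D' = {}"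
        using p assms(3,4) by (auto dest: disjointD)
      then show "?e p \<inter> ?e p' = {}" using CD by auto
    qed
  qed
  ultimately show ?thesis by (simp add: num_edges_between_def case_prod_unfold)
qed

lemma card_Union_mult:
  fixes \<A> \<B> :: "'a set set"
  assumes "finite \<A>" "finite \<B>" "disjoint \<A>" "disjoint \<B>" "finite (\<Union>\<A>)" "finite (\<Union>\<B>)"
  shows "card (\<Union>\<A>) * card (\<Union>\<B>) = (\<Sum>(C, D)\<in>\<A> \<times> \<B>. card C * card D)"
proof -
  have fin: "finite A" if "A \<in> \<A> \<or> A \<in> \<B>" for A
    using assms that by (meson Union_upper finite_subset)
  have "card (\<Union>\<A>) * card (\<Union>\<B>) = (\<Sum>A\<in>\<A>. card A) * (\<Sum>B\<in>\<B>. card B)"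
    using assms fin by (simp add: card_Union_disjoint disjoint_def pairwise_def disjnt_def)
  then show ?thesis by (simp add: sum_product sum.cartesian_product)
qed

text \<open>The defect form of Cauchy-Schwarz. With d the density of (A, B), the difference of the
  energies equals the sum of (e - d * w)^2 / w over all cells, since the cell sums of e and d * w
  agree. Keeping only the cells inside X and Y and applying Cauchy-Schwarz to them leaves the stated
  gain. A and B may coincide, so the lemma also covers diagonal pairs.\<close>

lemma energy_defect:
  assumes fin: "finite A" "finite B" and ne: "A \<noteq> {}" "B \<noteq> {}"
    and part: "partition_on A \<A>" "partition_on B \<B>"
    and X: "X \<subseteq> A" "\<And>C. C \<in> \<A> \<Longrightarrow> C \<subseteq> X \<or> C \<inter> X = {}"
    and Y: "Y \<subseteq> B" "\<And>D. D \<in> \<B> \<Longrightarrow> D \<subseteq> Y \<or> D \<inter> Y = {}"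
  shows "pair_energy E A B + real (card X) * real (card Y) *
      (edge_density E X Y - edge_density E A B)\<^sup>2 \<le> energy E \<A> \<B>"
proof -
  define d where "d = edge_density E A B"
  define e where "e = (\<lambda>(C, D). real (num_edges_between E C D))"
  define w where "w = (\<lambda>(C :: 'a set, D :: 'a set). real (card C) * real (card D))"
  have fA: "finite \<A>" "finite \<B>" using fin part finite_elements by blast+
  have dj: "disjoint \<A>" "disjoint \<B>" and un: "\<Union>\<A> = A" "\<Union>\<B> = B"
    using part by (auto simp: partition_on_def)
  have w0: "w p > 0" if "p \<in> \<A> \<times> \<B>" for p
  proof -
    obtain C D where p: "p = (C, D)" "C \<in> \<A>" "D \<in> \<B>"
      using \<open>p \<in> \<A> \<times> \<B>\<close> by blast
    have "finite C" "finite D" using p un fin by (metis Union_upper finite_subset)+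
    moreover have "C \<noteq> {}" "D \<noteq> {}" using p part by (auto simp: partition_on_def)
    ultimately show ?thesis by (simp add: p w_def card_gt_0_iff)
  qed
  define \<X> where "\<X> = {C \<in> \<A>. C \<subseteq> X}"
  define \<Y> where "\<Y> = {D \<in> \<B>. D \<subseteq> Y}"
  have UX: "\<Union>\<X> = X"
  proof
    show "X \<subseteq> \<Union>\<X>"
    proof
      fix x assume "x \<in> X"
      then obtain C where "C \<in> \<A>" "x \<in> C" using X(1) un(1) by blast
      then show "x \<in> \<Union>\<X>" using X(2)[of C] \<open>x \<in> X\<close> by (auto simp: \<X>_def)
    qed
  qed (auto simp: \<X>_def)
  have UY: "\<Union>\<Y> = Y"
  proof
    show "Y \<subseteq> \<Union>\<Y>"
    proof
      fix y assume "y \<in> Y"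
      then obtain D where "D \<in> \<B>" "y \<in> D" using Y(1) un(2) by blast
      then show "y \<in> \<Union>\<Y>" using Y(2)[of D] \<open>y \<in> Y\<close> by (auto simp: \<Y>_def)
    qed
  qed (auto simp: \<Y>_def)
  have XA: "\<X> \<subseteq> \<A>" "\<Y> \<subseteq> \<B>" by (auto simp: \<X>_def \<Y>_def)
  have fX: "finite \<X>" "finite \<Y>" "finite X" "finite Y"
    by (rule finite_subset[OF XA(1) fA(1)], rule finite_subset[OF XA(2) fA(2)],
        rule finite_subset[OF X(1) fin(1)], rule finite_subset[OF Y(1) fin(2)])
  have djX: "disjoint \<X>" "disjoint \<Y>" using XA dj by (auto intro: pairwise_subset)
  have sums: "(\<Sum>p\<in>\<A> \<times> \<B>. e p) = real (num_edges_between E A B)"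
    "(\<Sum>p\<in>\<A> \<times> \<B>. w p) = real (card A) * real (card B)"
    "(\<Sum>p\<in>\<X> \<times> \<Y>. e p) = real (num_edges_between E X Y)"
    "(\<Sum>p\<in>\<X> \<times> \<Y>. w p) = real (card X) * real (card Y)"
    using num_edges_between_Union[of \<A> \<B> E] num_edges_between_Union[of \<X> \<Y> E]
      card_Union_mult[of \<A> \<B>] card_Union_mult[of \<X> \<Y>] fA dj un fin fX djX UX UY
    by (simp_all add: e_def w_def case_prod_unfold flip: of_nat_mult)
  have ab: "real (card A) * real (card B) > 0" using fin ne by (simp add: card_gt_0_iff)
  have "real (card X) * real (card Y) * (edge_density E X Y - d)\<^sup>2
      = (\<Sum>p\<in>\<X> \<times> \<Y>. e p - d * w p)\<^sup>2 / (\<Sum>p\<in>\<X> \<times> \<Y>. w p)"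
  \<comment> \<open>For empty X or Y both sides vanish, the right one by division by zero.\<close>
  proof (cases "real (card X) * real (card Y) = 0")
    case True
    then show ?thesis unfolding sums by auto
  next
    case False
    then have "edge_density E X Y - d
      = (real (num_edges_between E X Y) - d * (real (card X) * real (card Y)))
         / (real (card X) * real (card Y))"
      unfolding edge_density_def[of E X Y] by (simp add: field_simps)
    moreover have "(\<Sum>p\<in>\<X> \<times> \<Y>. e p - d * w p)
      = real (num_edges_between E X Y) - d * (real (card X) * real (card Y))"
      by (simp add: sum_subtractf sums flip: sum_distrib_left)
    ultimately show ?thesis using False unfolding sums
      by (simp add: power_divide power2_eq_square)
  qed
  also have "\<dots> \<le> (\<Sum>p\<in>\<X> \<times> \<Y>. (e p - d * w p)\<^sup>2 / w p)"
    using fX XA w0 by (intro sum_squared_div_le) auto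
  also have "\<dots> \<le> (\<Sum>p\<in>\<A> \<times> \<B>. (e p - d * w p)\<^sup>2 / w p)"
    using fA XA w0 by (intro sum_mono2) (auto intro!: divide_nonneg_pos)
  also have "\<dots> = (\<Sum>p\<in>\<A> \<times> \<B>. (e p)\<^sup>2 / w p - 2 * d * e p + d\<^sup>2 * w p)"
  proof (intro sum.cong refl)
    fix p assume "p \<in> \<A> \<times> \<B>"
    then have "w p \<noteq> 0" using w0 by force
    then show "(e p - d * w p)\<^sup>2 / w p = (e p)\<^sup>2 / w p - 2 * d * e p + d\<^sup>2 * w p"
      by (simp add: power2_diff add_divide_distrib diff_divide_distrib power_mult_distrib)
         (simp add: power2_eq_square mult_ac)
  qed
  also have "\<dots> = (\<Sum>p\<in>\<A> \<times> \<B>. (e p)\<^sup>2 / w p) - 2 * d * real (num_edges_between E A B)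
      + d\<^sup>2 * (real (card A) * real (card B))"
    by (simp add: sum.distrib sum_subtractf sums flip: sum_distrib_left)
  also have "(\<Sum>p\<in>\<A> \<times> \<B>. (e p)\<^sup>2 / w p) = energy E \<A> \<B>"
    by (simp add: energy_def pair_energy_def e_def w_def sum.cartesian_product case_prod_unfold)
  also have "energy E \<A> \<B> - 2 * d * real (num_edges_between E A B)
      + d\<^sup>2 * (real (card A) * real (card B)) = energy E \<A> \<B> - pair_energy E A B"
    using ab unfolding d_def edge_density_def pair_energy_def
    by (simp add: power2_eq_square)
  finally show ?thesis by (simp add: d_def)
qed

text \<open>
  \<open>\<C>\<close> is the equitable splitting of \<open>U\<close> and \<open>\<Q>\<close> the refinement to which the defect inequality
  applies; they share all chunks on which membership in the sets of \<open>\<F>\<close> is constant, and these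
  cover almost all of \<open>U\<close>.
\<close>

lemma pure_chunks:
  assumes U: "finite U" and \<F>: "finite \<F>" and s: "s = card U div T" "s \<ge> T" "T \<ge> 1"
  shows "\<exists>\<Q> \<C>. partition_on U \<Q> \<and> (\<forall>F\<in>\<F>. \<forall>Q\<in>\<Q>. Q \<subseteq> F \<or> Q \<inter> F = {}) \<and>
    card (\<Union>(\<Q> - \<C>)) \<le> 2 ^ card \<F> * s \<and> disjoint \<C> \<and> (\<forall>C\<in>\<C>. C \<subseteq> U \<and> card C = s) \<and>
    finite \<C> \<and> card \<C> = T"
proof -
  define \<phi> where "\<phi> = (\<lambda>x. {F \<in> \<F>. x \<in> F})"
  \<comment> \<open>Points of equal type \<open>\<phi>\<close> are separated by no member of
    \<open>\<F>\<close>. A maximal disjoint family of chunks of constant type leaves fewer than s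
    points of each of the at most \<open>2 ^ card \<F>\<close> types.\<close>
  define \<S> where "\<S> = {\<C>. \<C> \<subseteq> Pow U \<and> disjoint \<C> \<and>
    (\<forall>C\<in>\<C>. card C = s \<and> (\<forall>x\<in>C. \<forall>y\<in>C. \<phi> x = \<phi> y))}"
  have "\<S> \<subseteq> Pow (Pow U)" by (auto simp: \<S>_def)
  then have "finite \<S>" using U by (meson finite_Pow_iff finite_subset)
  moreover have "{} \<in> \<S>" by (simp add: \<S>_def)
  ultimately obtain \<D> where \<D>: "\<D> \<in> \<S>" and max: "\<And>\<C>. \<C> \<in> \<S> \<Longrightarrow> \<D> \<subseteq> \<C> \<Longrightarrow> \<D> = \<C>"
    using finite_has_maximal[of \<S>] by blast
  have s0: "s > 0" using s by simp
  have DU: "\<D> \<subseteq> Pow U" "disjoint \<D>"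
    and Dc: "\<And>C. C \<in> \<D> \<Longrightarrow> card C = s"
    and Dp: "\<And>C x y. C \<in> \<D> \<Longrightarrow> x \<in> C \<Longrightarrow> y \<in> C \<Longrightarrow> \<phi> x = \<phi> y"
    using \<D> unfolding \<S>_def by blast+
  have finD: "finite \<D>" using DU U by (meson finite_Pow_iff finite_subset)
  have Dfin: "finite C" if "C \<in> \<D>" for C using DU U that by (meson PowD finite_subset subsetD)
  define R where "R = U - \<Union>\<D>"
  have finR: "finite R" using U by (simp add: R_def)
  define K where "K = (\<lambda>S. {x \<in> R. \<phi> x = S})"
  have K: "card (K S) < s" for S
  proof (rule ccontr)
    assume "\<not> card (K S) < s"
    then obtain C where C: "C \<subseteq> K S" "card C = s"
      by (meson not_less obtain_subset_with_card_n)
    have disj: "C \<inter> C' = {}" if "C' \<in> \<D>" for C' using C that by (auto simp: K_def R_def)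
    have "insert C \<D> \<in> \<S>" unfolding \<S>_def
    proof (intro CollectI conjI)
      show "insert C \<D> \<subseteq> Pow U" using C DU by (auto simp: K_def R_def)
      show "disjoint (insert C \<D>)"
        using DU(2) disj by (auto simp: pairwise_insert disjnt_def)
      show "\<forall>C'\<in>insert C \<D>. card C' = s \<and> (\<forall>x\<in>C'. \<forall>y\<in>C'. \<phi> x = \<phi> y)"
      proof
        fix C' assume "C' \<in> insert C \<D>"
        moreover have "\<phi> x = \<phi> y" if "x \<in> C" "y \<in> C" for x y
          using C(1) that unfolding K_def by blast
        ultimately show "card C' = s \<and> (\<forall>x\<in>C'. \<forall>y\<in>C'. \<phi> x = \<phi> y)"
          using C(2) Dc Dp by blast
      qed
    qed
    then have "C \<in> \<D>" using max by blast
    then have "C = {}" using disj by blast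
    then show False using C s0 by simp
  qed
  \<comment> \<open>The leftover of each type becomes a cell of \<open>\<Q>\<close>, pure but of the
    wrong size. The family \<open>\<C>\<close> instead recuts the leftovers into sets of size s, of
    mixed type.\<close>
  define \<Q> where "\<Q> = \<D> \<union> K ` (\<phi> ` R)"
  have "partition_on U \<Q>"
  proof (rule partition_onI)
    have "\<Union>(K ` (\<phi> ` R)) = R" by (auto simp: K_def)
    then show "\<Union>\<Q> = U" using DU by (auto simp: \<Q>_def R_def)
    fix p q assume pq: "p \<in> \<Q>" "q \<in> \<Q>" "p \<noteq> q"
    have 1: "disjnt p q" if "p \<in> \<D>" "q \<in> K ` (\<phi> ` R)" for p q
      using that by (auto simp: K_def R_def disjnt_def)
    have 2: "disjnt p q" if "p \<in> K ` (\<phi> ` R)" "q \<in> K ` (\<phi> ` R)" "p \<noteq> q" for p q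
      using that by (auto simp: K_def disjnt_def)
    have 3: "disjnt p q" if "p \<in> \<D>" "q \<in> \<D>" "p \<noteq> q" for p q
      using that DU(2) by (simp add: pairwise_def)
    from pq show "disjnt p q"
      unfolding \<Q>_def using 1 2 3 disjnt_sym by (metis UnE)
  next
    show "{} \<notin> \<Q>"
    proof
      assume "{} \<in> \<Q>"
      then show False using Dc s0 by (force simp: \<Q>_def K_def)
    qed
  qed
  moreover have "Q \<subseteq> F \<or> Q \<inter> F = {}" if "F \<in> \<F>" "Q \<in> \<Q>" for F Q
  proof -
    have pure: "\<phi> x = \<phi> y" if "x \<in> Q" "y \<in> Q" for x y
    proof (cases "Q \<in> \<D>")
      case True
      then show ?thesis using Dp that by blast
    next
      case False
      then show ?thesis using \<open>Q \<in> \<Q>\<close> that unfolding \<Q>_def K_def by blast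
    qed
    have "x \<in> F \<longleftrightarrow> y \<in> F" if "x \<in> Q" "y \<in> Q" for x y
      using pure[OF that] \<open>F \<in> \<F>\<close> unfolding \<phi>_def by blast
    then show ?thesis by blast
  qed
  moreover have "card R \<le> 2 ^ card \<F> * s"
  proof -
    have "R \<subseteq> (\<Union>S\<in>Pow \<F>. K S)"
    proof
      fix x assume "x \<in> R"
      then have "x \<in> K (\<phi> x)" "\<phi> x \<in> Pow \<F>" by (auto simp: K_def \<phi>_def)
      then show "x \<in> (\<Union>S\<in>Pow \<F>. K S)" by blast
    qed
    then have "card R \<le> card (\<Union>S\<in>Pow \<F>. K S)"
      using \<F> finR by (intro card_mono) (auto simp: K_def)
    also have "\<dots> \<le> (\<Sum>S\<in>Pow \<F>. card (K S))" using \<F> by (intro card_UN_le) auto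
    also have "\<dots> \<le> (\<Sum>S\<in>Pow \<F>. s)" using K by (intro sum_mono) (simp add: less_imp_le)
    finally show ?thesis using \<F> by (simp add: card_Pow)
  qed
  moreover have "\<exists>\<C>. \<D> \<subseteq> \<C> \<and> disjoint \<C> \<and> (\<forall>C\<in>\<C>. C \<subseteq> U \<and> card C = s) \<and> finite \<C> \<and> card \<C> = T"
  proof -
    have cU: "card (\<Union>\<D>) = card \<D> * s"
      using DU(2) Dfin Dc by (simp add: card_Union_disjoint)
    have sub: "\<Union>\<D> \<subseteq> U" using DU by blast
    then have "card \<D> * s \<le> card U" using U cU by (metis card_mono)
    \<comment> \<open>Here s \<ge> T matters: the remainder is less than T, hence less than s, so U
      has no room for T + 1 chunks and \<open>\<D>\<close> can be completed to exactly T.\<close>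
    also have Us: "card U = T * s + card U mod T" by (simp add: s)
    also have "T * s + card U mod T < T * s + s"
      using s(2,3) mod_less_divisor[of T "card U"] by linarith
    also have "\<dots> = Suc T * s" by simp
    finally have "card \<D> * s < Suc T * s" .
    then have DT: "card \<D> \<le> T" by (simp only: mult_less_cancel2 less_Suc_eq_le)
    have "card R = card U - card \<D> * s"
      unfolding R_def using sub U cU by (simp add: card_Diff_subset finite_subset)
    then have "(T - card \<D>) * s \<le> card R" using Us by (simp add: diff_mult_distrib)
    then obtain B where B: "disjoint_family_on B {..<T - card \<D>}"
      "\<forall>a<T - card \<D>. B a \<subseteq> R \<and> card (B a) = s"
      using disjoint_subsets_of_card[OF finR] by blast
    let ?B = "B ` {..<T - card \<D>}"
    have Bne: "B a \<noteq> {}" if "a < T - card \<D>" for a using B s0 that by force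
    have "inj_on B {..<T - card \<D>}"
    proof (rule inj_onI)
      fix a b assume "a \<in> {..<T - card \<D>}" "b \<in> {..<T - card \<D>}" "B a = B b"
      then show "a = b" using Bne[of a] B(1) unfolding disjoint_family_on_def
        by (metis Int_absorb lessThan_iff)
    qed
    then have cB: "card ?B = T - card \<D>" by (simp add: card_image)
    have DB: "C \<inter> B a = {}" if "C \<in> \<D>" "a < T - card \<D>" for C a
      using B that by (auto simp: R_def)
    have "\<D> \<inter> ?B = {}"
    proof (rule ccontr)
      assume "\<D> \<inter> ?B \<noteq> {}"
      then obtain a where "a < T - card \<D>" "B a \<in> \<D>" by auto
      then show False using DB[of "B a" a] Bne[of a] by simp
    qed
    then have "card (\<D> \<union> ?B) = T" using cB finD DT by (simp add: card_Un_disjoint)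
    moreover have "disjoint (\<D> \<union> ?B)"
    proof (rule disjoint_union)
      show "disjoint \<D>" by fact
      show "disjoint ?B" using B(1) by (rule disjoint_family_on_disjoint_image)
      show "\<Union>\<D> \<inter> \<Union>?B = {}" using DB by blast
    qed
    moreover have "\<forall>C\<in>\<D> \<union> ?B. C \<subseteq> U \<and> card C = s" using B DU Dc by (auto simp: R_def)
    moreover have "finite (\<D> \<union> ?B)" using finD by simp
    ultimately show ?thesis by blast
  qed
  then obtain \<C> where \<C>: "\<D> \<subseteq> \<C>" "disjoint \<C>" "\<forall>C\<in>\<C>. C \<subseteq> U \<and> card C = s" "finite \<C>" "card \<C> = T"
    by blast
  have "\<Union>(\<Q> - \<C>) \<subseteq> R" using \<C>(1) by (auto simp: \<Q>_def K_def)
  then have "card (\<Union>(\<Q> - \<C>)) \<le> card R" using finR by (rule card_mono[rotated])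
  ultimately show ?thesis using \<C> by (intro exI[of _ \<Q>] exI[of _ \<C>]) auto
qed

section \<open>Energy increment and its iteration\<close>

lemma not_uniform_pairE:
  assumes "\<not> uniform_pair \<delta> E A B"
  obtains X Y where "X \<subseteq> A" "Y \<subseteq> B" "real (card X) \<ge> \<delta> * real (card A)"
    "real (card Y) \<ge> \<delta> * real (card B)" "\<bar>edge_density E X Y - edge_density E A B\<bar> \<ge> \<delta>"
  using assms unfolding uniform_pair_def not_less[symmetric] by blast

text \<open>More than \<delta> * k^2 non-uniform pairs each gain at least (\<delta> * N)^2 *
  \<delta>^2 from cutting along their witnesses, where N is the common part size and k * N is at
  least half of card V. The total gain is at least \<delta>^5 / 4 times the square of card V, and at
  most half of it is lost by making the chunks equal.\<close>

lemma energy_increment: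
  fixes \<delta> :: real
  assumes \<delta>: "\<delta> > 0" and k: "k \<ge> 1"
  shows "\<exists>T\<ge>1. \<exists>n\<^sub>0. \<forall>(V :: 'a set) E P. finite V \<and> card V \<ge> n\<^sub>0 \<and> equitable_partition V k P \<and>
      \<not> uniform_partition \<delta> V E k P \<longrightarrow>
    (\<exists>W. equitable_partition V (k * T) W \<and> (\<forall>j\<in>{1..k * T}. \<exists>i\<in>{1..k}. W j \<subseteq> P i) \<and>
       energy E (P ` {1..k}) (P ` {1..k}) + \<delta> ^ 5 / 8 * (real (card V))\<^sup>2
         \<le> energy E (W ` {1..k * T}) (W ` {1..k * T}))"
proof -
  \<comment> \<open>The at most 2 * k witness sets in a part generate at most 4^k types, so at most
    k * 4^k * s vertices lie in cells that are not shared, where s * T \<le> N. The loss is at most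
    twice this number times card V, and T makes that at most \<delta>^5 / 8 times the square of card
    V.\<close>
  define T where "T = nat \<lceil>16 * 4 ^ k / \<delta> ^ 5\<rceil> + 1"
  have T: "T \<ge> 1" "16 * 4 ^ k / \<delta> ^ 5 \<le> real T" unfolding T_def by (simp, linarith)
  \<comment> \<open>Large enough to force N > T * T + 1, hence N div T \<ge> T as the chunking
    requires.\<close>
  define n\<^sub>0 where "n\<^sub>0 = k * (T * T + 2)"
  have "\<exists>W. equitable_partition V (k * T) W \<and> (\<forall>j\<in>{1..k * T}. \<exists>i\<in>{1..k}. W j \<subseteq> P i) \<and>
       energy E (P ` {1..k}) (P ` {1..k}) + \<delta> ^ 5 / 8 * (real (card V))\<^sup>2
         \<le> energy E (W ` {1..k * T}) (W ` {1..k * T})"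
    if V: "finite V" and large: "card V \<ge> n\<^sub>0" and P: "equitable_partition V k P"
      and irr: "\<not> uniform_partition \<delta> V E k P" for V :: "'a set" and E P
  proof -
    define I where "I = {1..k}"
    define N where "N = card (P 1)"
    have I1: "1 \<in> I" using k by (simp add: I_def)
    have cP: "card (P i) = N" if "i \<in> I" for i
      using P that I1 unfolding equitable_partition_def N_def I_def by blast
    have cV: "card V = card (P 0) + k * N"
      using equitable_partition_card[OF V P, of 1] k by (simp add: N_def)
    have P0: "card (P 0) < k" using P by (simp only: equitable_partition_def)
    have PV: "P i \<subseteq> V" if "i \<in> I" for i
      using P that unfolding equitable_partition_def I_def by fastforce
    have finP: "finite (P i)" if "i \<in> I" for i using PV[OF that] V finite_subset by blast
    have dP: "P i \<inter> P j = {}" if "i \<in> I" "j \<in> I" "i \<noteq> j" for i j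
    proof -
      have "disjoint_family_on P {0..k}" using P by (simp only: equitable_partition_def)
      then show ?thesis using that by (auto simp: disjoint_family_on_def I_def)
    qed
    have "k * (T * T + 2) < k + k * N" using large cV P0 by (simp add: n\<^sub>0_def)
    also have "k + k * N = k * (N + 1)" by simp
    finally have "T * T + 2 < N + 1" using k by (simp only: mult_less_cancel1)
    then have N: "T * T + 1 < N" by simp
    define s where "s = N div T"
    have sT: "s \<ge> T"
    proof -
      have "T * T div T \<le> N div T" using N by (intro div_le_mono) auto
      then show ?thesis using T by (simp add: s_def)
    qed
    have Pne: "P i \<noteq> {}" if "i \<in> I" for i using cP[OF that] N by auto
    have injP: "inj_on P I"
    proof (rule inj_onI)
      fix i j assume "i \<in> I" "j \<in> I" "P i = P j"
      then show "i = j" using dP[of i j] Pne[of i] by auto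
    qed
    define bad where "bad = {(i, j). 1 \<le> i \<and> i < j \<and> j \<le> k \<and> \<not> uniform_pair \<delta> E (P i) (P j)}"
    have badI: "bad \<subseteq> I \<times> I" by (auto simp: bad_def I_def)
    have bad: "real (card bad) > \<delta> * (real k)\<^sup>2"
      using irr P by (simp add: uniform_partition_def bad_def)
    have "\<forall>p. \<exists>X Y. p \<in> bad \<longrightarrow> X \<subseteq> P (fst p) \<and> Y \<subseteq> P (snd p) \<and>
        real (card X) \<ge> \<delta> * real (card (P (fst p))) \<and> real (card Y) \<ge> \<delta> * real (card (P (snd p))) \<and>
        \<bar>edge_density E X Y - edge_density E (P (fst p)) (P (snd p))\<bar> \<ge> \<delta>"
    proof
      fix p
      show "\<exists>X Y. p \<in> bad \<longrightarrow> X \<subseteq> P (fst p) \<and> Y \<subseteq> P (snd p) \<and>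
        real (card X) \<ge> \<delta> * real (card (P (fst p))) \<and> real (card Y) \<ge> \<delta> * real (card (P (snd p))) \<and>
        \<bar>edge_density E X Y - edge_density E (P (fst p)) (P (snd p))\<bar> \<ge> \<delta>"
      proof (cases "p \<in> bad")
        case True
        then have "\<not> uniform_pair \<delta> E (P (fst p)) (P (snd p))" by (auto simp: bad_def)
        then show ?thesis by (rule not_uniform_pairE) blast
      qed simp
    qed
    then obtain X Y where XY: "\<And>p. p \<in> bad \<Longrightarrow> X p \<subseteq> P (fst p) \<and> Y p \<subseteq> P (snd p) \<and>
        real (card (X p)) \<ge> \<delta> * real (card (P (fst p))) \<and>
        real (card (Y p)) \<ge> \<delta> * real (card (P (snd p))) \<and>
        \<bar>edge_density E (X p) (Y p) - edge_density E (P (fst p)) (P (snd p))\<bar> \<ge> \<delta>"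
      by metis
    \<comment> \<open>All j are included: for pairs outside \<open>bad\<close> the chosen sets are
      arbitrary, which is harmless because cutting along them cannot lower the energy and only their
      number enters the bounds.\<close>
    define \<F> where "\<F> = (\<lambda>i. (\<lambda>j. X (i, j)) ` I \<union> (\<lambda>j. Y (j, i)) ` I)"
    have F: "finite (\<F> i)" "card (\<F> i) \<le> 2 * k" for i
    proof -
      show "finite (\<F> i)" by (simp add: \<F>_def I_def)
      have "card (\<F> i) \<le> card ((\<lambda>j. X (i, j)) ` I) + card ((\<lambda>j. Y (j, i)) ` I)"
        unfolding \<F>_def by (rule card_Un_le)
      also have "\<dots> \<le> card I + card I"
        by (intro add_mono card_image_le) (auto simp: I_def)
      finally show "card (\<F> i) \<le> 2 * k" by (simp add: I_def)
    qed
    have "\<forall>i\<in>I. \<exists>\<Q> \<C>. partition_on (P i) \<Q> \<and> (\<forall>F\<in>\<F> i. \<forall>Q\<in>\<Q>. Q \<subseteq> F \<or> Q \<inter> F = {}) \<and>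
      card (\<Union>(\<Q> - \<C>)) \<le> 2 ^ card (\<F> i) * s \<and> disjoint \<C> \<and>
      (\<forall>C\<in>\<C>. C \<subseteq> P i \<and> card C = s) \<and> finite \<C> \<and> card \<C> = T"
      using pure_chunks[OF finP F(1) _ sT T(1)] cP by (simp add: s_def)
    then obtain \<Q> \<C> where QC: "\<forall>i\<in>I. partition_on (P i) (\<Q> i) \<and>
      (\<forall>F\<in>\<F> i. \<forall>Q\<in>\<Q> i. Q \<subseteq> F \<or> Q \<inter> F = {}) \<and>
      card (\<Union>(\<Q> i - \<C> i)) \<le> 2 ^ card (\<F> i) * s \<and> disjoint (\<C> i) \<and>
      (\<forall>C\<in>\<C> i. C \<subseteq> P i \<and> card C = s) \<and> finite (\<C> i) \<and> card (\<C> i) = T"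
      by metis
    then have Q: "partition_on (P i) (\<Q> i)" "\<And>F Q. F \<in> \<F> i \<Longrightarrow> Q \<in> \<Q> i \<Longrightarrow> Q \<subseteq> F \<or> Q \<inter> F = {}"
      "card (\<Union>(\<Q> i - \<C> i)) \<le> 2 ^ card (\<F> i) * s" "disjoint (\<C> i)"
      "\<And>C. C \<in> \<C> i \<Longrightarrow> C \<subseteq> P i \<and> card C = s" "finite (\<C> i)" "card (\<C> i) = T"
      if "i \<in> I" for i using that by blast+
    have "\<forall>i\<in>I. \<exists>h. bij_betw h {..<T} (\<C> i)"
      using Q(6,7) by (metis bij_betw_from_nat_into_finite)
    then obtain h where h: "\<And>i. i \<in> I \<Longrightarrow> bij_betw (h i) {..<T} (\<C> i)" by metis
    define W where "W = subdivision V k T h"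
    have hC: "h i a \<in> \<C> i" if "i \<in> I" "a < T" for i a
      using h[OF that(1)] that(2) by (auto simp: bij_betw_def)
    have hP: "h i a \<subseteq> P i" if "i \<in> I" "a < T" for i a
      using hC Q(5) that by blast
    have W: "equitable_partition V (k * T) W" unfolding W_def
    proof (rule equitable_partition_subdivision[OF V P k])
      fix i assume "i \<in> {1..k}"
      then have i: "i \<in> I" by (simp add: I_def)
      show "disjoint_family_on (h i) {..<T}"
        unfolding disjoint_family_on_def
      proof (intro ballI impI)
        fix a b assume ab: "a \<in> {..<T}" "b \<in> {..<T}" "a \<noteq> b"
        then have "h i a \<noteq> h i b" using h[OF i] by (auto simp: bij_betw_def inj_on_def)
        then show "h i a \<inter> h i b = {}"
          using Q(4)[OF i] hC[OF i] ab by (auto dest: disjointD)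
      qed
    next
      fix i a assume "i \<in> {1..k}" "a < T"
      then have "i \<in> I" "a < T" by (auto simp: I_def)
      then show "h i a \<subseteq> P i \<and> card (h i a) = card (P i) div T"
        using hC Q(5) cP by (simp add: s_def)
    qed (rule T(1))
    have ref: "\<forall>j\<in>{1..k * T}. \<exists>i\<in>{1..k}. W j \<subseteq> P i"
    proof
      fix j assume j: "j \<in> {1..k * T}"
      have "h ((j - 1) div T + 1) ((j - 1) mod T) \<subseteq> P ((j - 1) div T + 1)"
        using subdivision_index[OF j] by (intro hP) (auto simp: I_def)
      then show "\<exists>i\<in>{1..k}. W j \<subseteq> P i"
        using subdivision_index(1)[OF j] j unfolding W_def subdivision_def by auto
    qed
    define \<A> where "\<A> = (\<Union>i\<in>I. \<Q> i)"
    have WC: "W ` {1..k * T} = (\<Union>i\<in>I. \<C> i)"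
      unfolding W_def subdivision_image I_def[symmetric]
      using h by (simp add: bij_betw_def)
    have QP: "C \<subseteq> P i" "C \<noteq> {}" if "i \<in> I" "C \<in> \<Q> i" for i C
      using Q(1)[OF that(1)] that(2) by (auto simp: partition_on_def)
    have finQ: "finite (\<Q> i)" if "i \<in> I" for i
      using finite_elements[OF finP[OF that] Q(1)[OF that]] .
    have finA: "finite \<A>" unfolding \<A>_def using finQ by (auto simp: I_def)
    have QQ: "\<Q> i \<inter> \<Q> j = {}" if "i \<in> I" "j \<in> I" "i \<noteq> j" for i j
    proof (rule ccontr)
      assume "\<Q> i \<inter> \<Q> j \<noteq> {}"
      then obtain C where "C \<in> \<Q> i" "C \<in> \<Q> j" by blast
      then have "C \<subseteq> P i \<inter> P j" "C \<noteq> {}" using QP that by blast+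
      then show False using dP[OF that] by blast
    qed
    have djA: "disjoint \<A>"
    proof (rule disjointI)
      fix C D assume "C \<in> \<A>" "D \<in> \<A>" and CD: "C \<noteq> D"
      then obtain i j where ij: "i \<in> I" "j \<in> I" "C \<in> \<Q> i" "D \<in> \<Q> j" by (auto simp: \<A>_def)
      show "C \<inter> D = {}"
      proof (cases "i = j")
        case True
        have "disjoint (\<Q> i)" using Q(1)[OF ij(1)] by (simp add: partition_on_def)
        then show ?thesis using ij True CD by (auto dest: disjointD)
      next
        case False
        then show ?thesis using dP[OF ij(1,2)] QP(1)[OF ij(1,3)] QP(1)[OF ij(2,4)] by blast
      qed
    qed
    have AV: "\<Union>\<A> \<subseteq> V" using QP(1) PV by (force simp: \<A>_def)
    have finC: "finite (\<Union>i\<in>I. \<C> i)" using Q(6) by (auto simp: I_def)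
    have unc: "real (card (\<Union>(\<A> - (\<Union>i\<in>I. \<C> i)))) \<le> real k * 4 ^ k * real s"
    proof -
      have "\<Union>(\<A> - (\<Union>i\<in>I. \<C> i)) \<subseteq> (\<Union>i\<in>I. \<Union>(\<Q> i - \<C> i))" by (auto simp: \<A>_def)
      moreover have "(\<Union>i\<in>I. \<Union>(\<Q> i - \<C> i)) \<subseteq> V" using AV by (auto simp: \<A>_def)
      ultimately have "card (\<Union>(\<A> - (\<Union>i\<in>I. \<C> i))) \<le> card (\<Union>i\<in>I. \<Union>(\<Q> i - \<C> i))"
        using V finite_subset by (intro card_mono) blast+
      also have "\<dots> \<le> (\<Sum>i\<in>I. card (\<Union>(\<Q> i - \<C> i)))" by (rule card_UN_le) (simp add: I_def)
      also have "\<dots> \<le> (\<Sum>i\<in>I. 4 ^ k * s)"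
      proof (intro sum_mono)
        fix i assume "i \<in> I"
        have "(2::nat) ^ card (\<F> i) \<le> 2 ^ (2 * k)" using F(2)[of i] by (intro power_increasing) auto
        then have "2 ^ card (\<F> i) * s \<le> 4 ^ k * s" by (simp add: power_mult)
        then show "card (\<Union>(\<Q> i - \<C> i)) \<le> 4 ^ k * s" using Q(3)[OF \<open>i \<in> I\<close>] by linarith
      qed
      also have "\<dots> = k * 4 ^ k * s" by (simp add: I_def)
      finally have "real (card (\<Union>(\<A> - (\<Union>i\<in>I. \<C> i)))) \<le> real (k * 4 ^ k * s)" by (rule of_nat_mono)
      then show ?thesis by simp
    qed
    \<comment> \<open>For pairs outside \<open>bad\<close>, among them the diagonal ones, the defect
      inequality with empty X and Y is just monotonicity of energy under refinement. A non-uniform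
      pair is credited in one order only.\<close>
    have gain: "pair_energy E (P i) (P j) + (if (i, j) \<in> bad then \<delta> ^ 4 * (real N)\<^sup>2 else 0)
        \<le> energy E (\<Q> i) (\<Q> j)" if ij: "i \<in> I" "j \<in> I" for i j
    proof (cases "(i, j) \<in> bad")
      case False
      have "pair_energy E (P i) (P j) + real (card ({} :: 'a set)) * real (card ({} :: 'a set)) *
          (edge_density E {} {} - edge_density E (P i) (P j))\<^sup>2 \<le> energy E (\<Q> i) (\<Q> j)"
        using ij finP Pne Q(1) by (intro energy_defect) auto
      then show ?thesis using False by simp
    next
      case True
      define x where "x = X (i, j)"
      define y where "y = Y (i, j)"
      have xy: "x \<subseteq> P i" "y \<subseteq> P j" "real (card x) \<ge> \<delta> * real N" "real (card y) \<ge> \<delta> * real N"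
        "\<bar>edge_density E x y - edge_density E (P i) (P j)\<bar> \<ge> \<delta>"
        using XY[OF True] cP ij by (auto simp: x_def y_def)
      have "x \<in> \<F> i" "y \<in> \<F> j" using ij by (auto simp: \<F>_def x_def y_def)
      then have "pair_energy E (P i) (P j) + real (card x) * real (card y) *
          (edge_density E x y - edge_density E (P i) (P j))\<^sup>2 \<le> energy E (\<Q> i) (\<Q> j)"
        using ij finP Pne Q(1,2) xy(1,2) by (intro energy_defect) auto
      moreover have "\<delta> ^ 4 * (real N)\<^sup>2 \<le> real (card x) * real (card y) *
          (edge_density E x y - edge_density E (P i) (P j))\<^sup>2"
      proof -
        have 1: "\<delta>\<^sup>2 \<le> \<bar>edge_density E x y - edge_density E (P i) (P j)\<bar>\<^sup>2"
          using xy(5) \<delta> by (intro power_mono) auto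
        have 2: "(\<delta> * real N) * (\<delta> * real N) \<le> real (card x) * real (card y)"
          using xy \<delta> by (intro mult_mono) auto
        have "((\<delta> * real N) * (\<delta> * real N)) * \<delta>\<^sup>2 \<le> real (card x) * real (card y) *
            \<bar>edge_density E x y - edge_density E (P i) (P j)\<bar>\<^sup>2"
          by (rule mult_mono[OF 2 1]) auto
        then show ?thesis by (simp add: power2_eq_square power4_eq_xxxx mult_ac)
      qed
      ultimately show ?thesis using True by simp
    qed
    have "energy E (P ` I) (P ` I) + real (card bad) * (\<delta> ^ 4 * (real N)\<^sup>2)
      = (\<Sum>i\<in>I. \<Sum>j\<in>I. pair_energy E (P i) (P j)
           + (if (i, j) \<in> bad then \<delta> ^ 4 * (real N)\<^sup>2 else 0))"
    proof -
      have "(\<Sum>i\<in>I. \<Sum>j\<in>I. (if (i, j) \<in> bad then \<delta> ^ 4 * (real N)\<^sup>2 else 0))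
        = (\<Sum>p\<in>I \<times> I. (if p \<in> bad then \<delta> ^ 4 * (real N)\<^sup>2 else 0))"
        by (simp add: sum.cartesian_product case_prod_unfold)
      also have "\<dots> = (\<Sum>p\<in>(I \<times> I) \<inter> bad. \<delta> ^ 4 * (real N)\<^sup>2)"
        by (rule sum.inter_restrict[symmetric]) (simp add: I_def)
      also have "(I \<times> I) \<inter> bad = bad" using badI by blast
      finally show ?thesis
        by (simp add: energy_def sum.reindex[OF injP] sum.distrib)
    qed
    also have "\<dots> \<le> (\<Sum>i\<in>I. \<Sum>j\<in>I. energy E (\<Q> i) (\<Q> j))"
      using gain by (intro sum_mono)
    also have "\<dots> = energy E \<A> \<A>"
    proof -
      have "energy E \<A> \<A> = (\<Sum>i\<in>I. \<Sum>A\<in>\<Q> i. \<Sum>B\<in>\<A>. pair_energy E A B)"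
        unfolding energy_def \<A>_def using finQ QQ
        by (intro sum.UNION_disjoint) (auto simp: I_def)
      also have "\<dots> = (\<Sum>i\<in>I. \<Sum>A\<in>\<Q> i. \<Sum>j\<in>I. \<Sum>B\<in>\<Q> j. pair_energy E A B)"
        unfolding \<A>_def using finQ QQ
        by (intro sum.cong refl sum.UNION_disjoint) (auto simp: I_def)
      also have "\<dots> = (\<Sum>i\<in>I. \<Sum>j\<in>I. \<Sum>A\<in>\<Q> i. \<Sum>B\<in>\<Q> j. pair_energy E A B)"
        by (intro sum.cong refl sum.swap)
      finally show ?thesis by (simp add: energy_def)
    qed
    also have "\<dots> \<le> energy E (W ` {1..k * T}) (W ` {1..k * T})
        + 2 * real (card (\<Union>(\<A> - (\<Union>i\<in>I. \<C> i)))) * real (card V)"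
      unfolding WC by (rule energy_le_add_uncovered[OF finA djA AV V finC])
    finally have main: "energy E (P ` I) (P ` I) + real (card bad) * (\<delta> ^ 4 * (real N)\<^sup>2)
      \<le> energy E (W ` {1..k * T}) (W ` {1..k * T})
        + 2 * real (card (\<Union>(\<A> - (\<Union>i\<in>I. \<C> i)))) * real (card V)" .
    define v where "v = real (card V)"
    have v: "v / 2 \<le> real k * real N" "real k * real N \<le> v" "v \<ge> 0"
    proof -
      have "k * 1 \<le> k * N" using N by (intro mult_le_mono2) simp
      then have "card V \<le> 2 * (k * N)" using cV P0 by linarith
      then have "real (card V) \<le> real (2 * (k * N))" by (rule of_nat_mono)
      then show "v / 2 \<le> real k * real N" by (simp add: v_def)
      have "real (k * N) \<le> real (card V)" using cV by (intro of_nat_mono) simp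
      then show "real k * real N \<le> v" by (simp add: v_def)
    qed (simp add: v_def)
    have g: "real (card bad) * (\<delta> ^ 4 * (real N)\<^sup>2) \<ge> \<delta> ^ 5 / 4 * v\<^sup>2"
    proof -
      have "\<delta> ^ 5 / 4 * v\<^sup>2 = \<delta> ^ 5 * (v / 2)\<^sup>2" by (simp add: power2_eq_square)
      also have "\<dots> \<le> \<delta> ^ 5 * (real k * real N)\<^sup>2"
        using v \<delta> by (intro mult_left_mono power_mono) auto
      also have "\<dots> = (\<delta> * (real k)\<^sup>2) * (\<delta> ^ 4 * (real N)\<^sup>2)"
        by (simp add: power_mult_distrib mult_ac numeral_eq_Suc)
      also have "\<dots> \<le> real (card bad) * (\<delta> ^ 4 * (real N)\<^sup>2)"
        using bad \<delta> by (intro mult_right_mono) auto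
      finally show ?thesis .
    qed
    have l: "2 * real (card (\<Union>(\<A> - (\<Union>i\<in>I. \<C> i)))) * v \<le> \<delta> ^ 5 / 8 * v\<^sup>2"
    proof -
      have "real s * real T \<le> real N"
        unfolding of_nat_mult[symmetric] s_def by (intro of_nat_mono) simp
      have T': "16 * 4 ^ k \<le> \<delta> ^ 5 * real T" using T(2) \<delta> by (simp add: field_simps)
      have "16 * (real k * 4 ^ k * real s) = (16 * 4 ^ k) * (real k * real s)" by simp
      also have "\<dots> \<le> (\<delta> ^ 5 * real T) * (real k * real s)" using T' by (intro mult_right_mono) auto
      also have "\<dots> = \<delta> ^ 5 * (real k * (real s * real T))" by simp
      also have "\<dots> \<le> \<delta> ^ 5 * (real k * real N)"
        using \<open>real s * real T \<le> real N\<close> \<delta> by (intro mult_left_mono) auto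
      also have "\<dots> \<le> \<delta> ^ 5 * v" using v \<delta> by (intro mult_left_mono) auto
      finally have "2 * real (card (\<Union>(\<A> - (\<Union>i\<in>I. \<C> i)))) \<le> \<delta> ^ 5 / 8 * v" using unc by linarith
      then have "2 * real (card (\<Union>(\<A> - (\<Union>i\<in>I. \<C> i)))) * v \<le> \<delta> ^ 5 / 8 * v * v"
        using v by (intro mult_right_mono)
      then show ?thesis by (simp add: power2_eq_square)
    qed
    have "energy E (P ` I) (P ` I) + \<delta> ^ 5 / 8 * v\<^sup>2 \<le> energy E (W ` {1..k * T}) (W ` {1..k * T})"
      using main[folded v_def] g l by linarith
    then show ?thesis using W ref unfolding I_def v_def by blast
  qed
  then show ?thesis using T(1) by blast
qed

text \<open>After t rounds either some round has already produced a uniform partition, which is then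
  kept, or every round has added its increment. The bound M depends on k, \<delta> and t but not on
  the graph.\<close>

lemma energy_iteration:
  fixes \<delta> :: real
  assumes \<delta>: "\<delta> > 0" and k: "k \<ge> 1"
  shows "\<exists>M n\<^sub>0. \<forall>(V :: 'a set) E P. finite V \<and> card V \<ge> n\<^sub>0 \<and> equitable_partition V k P \<longrightarrow>
    (\<exists>q W. k \<le> q \<and> q \<le> M \<and> equitable_partition V q W \<and>
       (\<forall>j\<in>{1..q}. \<exists>i\<in>{1..k}. W j \<subseteq> P i) \<and>
       (uniform_partition \<delta> V E q W \<or>
        real t * (\<delta> ^ 5 / 8 * (real (card V))\<^sup>2) \<le> energy E (W ` {1..q}) (W ` {1..q})))"
proof (induction t)
  case 0
  have "\<exists>q W. k \<le> q \<and> q \<le> k \<and> equitable_partition V q W \<and>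
       (\<forall>j\<in>{1..q}. \<exists>i\<in>{1..k}. W j \<subseteq> P i) \<and>
       (uniform_partition \<delta> V E q W \<or>
        real 0 * (\<delta> ^ 5 / 8 * (real (card V))\<^sup>2) \<le> energy E (W ` {1..q}) (W ` {1..q}))"
    if "equitable_partition V k P" for V :: "'a set" and E P
    using that by (intro exI[of _ k] exI[of _ P]) (auto simp: energy_nonneg)
  then show ?case by blast
next
  case (Suc t)
  then obtain M n\<^sub>0 where IH: "\<forall>(V :: 'a set) E P.
    finite V \<and> card V \<ge> n\<^sub>0 \<and> equitable_partition V k P \<longrightarrow>
    (\<exists>q W. k \<le> q \<and> q \<le> M \<and> equitable_partition V q W \<and>
       (\<forall>j\<in>{1..q}. \<exists>i\<in>{1..k}. W j \<subseteq> P i) \<and>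
       (uniform_partition \<delta> V E q W \<or>
        real t * (\<delta> ^ 5 / 8 * (real (card V))\<^sup>2) \<le> energy E (W ` {1..q}) (W ` {1..q})))"
    by (elim exE) (rule that)
  \<comment> \<open>Naming the increment statement allows T and the order bound to be chosen as
    functions of q.\<close>
  define Inc where "Inc q T n \<longleftrightarrow> (\<forall>(V :: 'a set) E P. finite V \<and> card V \<ge> n \<and>
      equitable_partition V q P \<and> \<not> uniform_partition \<delta> V E q P \<longrightarrow>
    (\<exists>W. equitable_partition V (q * T) W \<and> (\<forall>j\<in>{1..q * T}. \<exists>i\<in>{1..q}. W j \<subseteq> P i) \<and>
       energy E (P ` {1..q}) (P ` {1..q}) + \<delta> ^ 5 / 8 * (real (card V))\<^sup>2
         \<le> energy E (W ` {1..q * T}) (W ` {1..q * T})))" for q T n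
  have "\<forall>q\<ge>1. \<exists>T\<ge>1. \<exists>n. Inc q T n"
    unfolding Inc_def by (intro allI impI energy_increment[OF \<delta>])
  then obtain T n\<^sub>1 where T: "\<And>q. q \<ge> 1 \<Longrightarrow> T q \<ge> 1"
    and Inc: "\<And>q. q \<ge> 1 \<Longrightarrow> Inc q (T q) (n\<^sub>1 q)" by metis
  \<comment> \<open>The number q of parts is known only to be at most M, so sums over all such q
    stand in for maxima.\<close>
  define M' where "M' = M + (\<Sum>q\<le>M. q * T q)"
  define n\<^sub>0' where "n\<^sub>0' = n\<^sub>0 + (\<Sum>q\<le>M. n\<^sub>1 q)"
  have "\<exists>q W. k \<le> q \<and> q \<le> M' \<and> equitable_partition V q W \<and>
       (\<forall>j\<in>{1..q}. \<exists>i\<in>{1..k}. W j \<subseteq> P i) \<and>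
       (uniform_partition \<delta> V E q W \<or>
        real (Suc t) * (\<delta> ^ 5 / 8 * (real (card V))\<^sup>2) \<le> energy E (W ` {1..q}) (W ` {1..q}))"
    if V: "finite V" and large: "card V \<ge> n\<^sub>0'" and P: "equitable_partition V k P"
    for V :: "'a set" and E P
  proof -
    have "card V \<ge> n\<^sub>0" using large by (simp add: n\<^sub>0'_def)
    with V P IH[rule_format, of V P E] obtain q W where q: "k \<le> q" "q \<le> M"
      and W: "equitable_partition V q W" "\<And>j. j \<in> {1..q} \<Longrightarrow> \<exists>i\<in>{1..k}. W j \<subseteq> P i"
      and en: "uniform_partition \<delta> V E q W \<or>
        real t * (\<delta> ^ 5 / 8 * (real (card V))\<^sup>2) \<le> energy E (W ` {1..q}) (W ` {1..q})"
      by auto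
    show ?thesis
    proof (cases "uniform_partition \<delta> V E q W")
      case True
      have "q \<le> M'" using q by (simp add: M'_def)
      with True q W show ?thesis by blast
    next
      case False
      have q1: "q \<ge> 1" using q k by simp
      have "n\<^sub>1 q \<le> (\<Sum>q\<le>M. n\<^sub>1 q)" using q by (intro member_le_sum) auto
      then have "card V \<ge> n\<^sub>1 q" using large by (simp add: n\<^sub>0'_def)
      with V W(1) False Inc[OF q1, unfolded Inc_def, rule_format, of V W E] obtain W' where
        W': "equitable_partition V (q * T q) W'" "\<And>j. j \<in> {1..q * T q} \<Longrightarrow> \<exists>i\<in>{1..q}. W' j \<subseteq> W i"
        and en': "energy E (W ` {1..q}) (W ` {1..q}) + \<delta> ^ 5 / 8 * (real (card V))\<^sup>2
         \<le> energy E (W' ` {1..q * T q}) (W' ` {1..q * T q})" by auto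
      have "q * T q \<le> (\<Sum>q\<le>M. q * T q)"
        using q by (intro member_le_sum[where f = "\<lambda>q. q * T q"]) auto
      then have "q * T q \<le> M'" by (simp add: M'_def)
      moreover have "q * 1 \<le> q * T q" using T[OF q1] by (rule mult_le_mono2)
      then have "k \<le> q * T q" using q by linarith
      moreover have "\<exists>i\<in>{1..k}. W' j \<subseteq> P i" if "j \<in> {1..q * T q}" for j
        using W'(2)[OF that] W(2) by (meson order_trans)
      moreover have "real (Suc t) * (\<delta> ^ 5 / 8 * (real (card V))\<^sup>2)
          \<le> energy E (W' ` {1..q * T q}) (W' ` {1..q * T q})"
        using en en' False by (simp add: distrib_right)
      ultimately show ?thesis using W'(1) by blast
    qed
  qed
  then show ?case by blast
qed

lemma equitable_partition_energy_le:
  assumes V: "finite V" and W: "equitable_partition V q W"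
  shows "energy E (W ` {1..q}) (W ` {1..q}) \<le> (real (card V))\<^sup>2"
proof -
  have WV: "\<Union>(W ` {1..q}) \<subseteq> V" using W unfolding equitable_partition_def by fastforce
  have "disjoint_family_on W {0..q}" using W by (simp only: equitable_partition_def)
  then have "disjoint_family_on W {1..q}" by (rule disjoint_family_on_mono[rotated]) simp
  then have dj: "disjoint (W ` {1..q})" by (rule disjoint_family_on_disjoint_image)
  have fin: "finite (\<Union>(W ` {1..q}))" using WV V finite_subset by blast
  have c: "real (card (\<Union>(W ` {1..q}))) \<le> real (card V)"
    using WV V by (intro of_nat_mono card_mono)
  have "energy E (W ` {1..q}) (W ` {1..q})
      \<le> real (card (\<Union>(W ` {1..q}))) * real (card (\<Union>(W ` {1..q})))"
    using dj fin by (intro energy_le) auto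
  also have "\<dots> \<le> real (card V) * real (card V)" using c by (intro mult_mono) auto
  finally show ?thesis by (simp add: power2_eq_square)
qed

text \<open>Energy never exceeds the square of card V, so more than 8 / \<delta>^5 increments are
  impossible and the iteration must end with the uniform alternative. Starting from an arbitrary
  refinement into k * max l 1 parts guarantees at least l parts.\<close>

lemma szemeredi_regularity_refining:
  fixes \<delta> :: real
  assumes \<delta>: "\<delta> > 0" and k: "k \<ge> 1"
  shows "\<exists>M n\<^sub>0. \<forall>(V :: 'a set) E P. finite V \<and> card V \<ge> n\<^sub>0 \<and> equitable_partition V k P \<longrightarrow>
    (\<exists>q W. k \<le> q \<and> l \<le> q \<and> q \<le> M \<and> uniform_partition \<delta> V E q W \<and>
       (\<forall>j\<in>{1..q}. \<exists>i\<in>{1..k}. W j \<subseteq> P i))"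
proof -
  define m where "m = max l 1"
  have km: "k * m \<ge> 1" "k \<le> k * m" "l \<le> k * m"
  proof -
    have "k * 1 \<le> k * m" "1 * m \<le> k * m" using k unfolding m_def by (intro mult_le_mono; simp)+
    then show "k * m \<ge> 1" "k \<le> k * m" "l \<le> k * m" using k by (auto simp: m_def)
  qed
  define t where "t = nat \<lceil>8 / \<delta> ^ 5\<rceil> + 1"
  have "8 / \<delta> ^ 5 < real t" unfolding t_def by linarith
  then have t: "1 < real t * (\<delta> ^ 5 / 8)" using \<delta> by (simp add: field_simps)
  from energy_iteration[OF \<delta> km(1), of t] obtain M n\<^sub>0 where it: "\<forall>(V :: 'a set) E P.
    finite V \<and> card V \<ge> n\<^sub>0 \<and> equitable_partition V (k * m) P \<longrightarrow>
    (\<exists>q W. k * m \<le> q \<and> q \<le> M \<and> equitable_partition V q W \<and>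
       (\<forall>j\<in>{1..q}. \<exists>i\<in>{1..k * m}. W j \<subseteq> P i) \<and>
       (uniform_partition \<delta> V E q W \<or>
        real t * (\<delta> ^ 5 / 8 * (real (card V))\<^sup>2) \<le> energy E (W ` {1..q}) (W ` {1..q})))"
    by (elim exE) (rule that)
  have "\<exists>q W. k \<le> q \<and> l \<le> q \<and> q \<le> M \<and> uniform_partition \<delta> V E q W \<and>
       (\<forall>j\<in>{1..q}. \<exists>i\<in>{1..k}. W j \<subseteq> P i)"
    if V: "finite V" and large: "card V \<ge> n\<^sub>0 + 1" and P: "equitable_partition V k P"
    for V :: "'a set" and E P
  proof -
    have "m \<ge> 1" by (simp add: m_def)
    from equitable_partition_refine[OF V P k this] obtain P' where
      P': "equitable_partition V (k * m) P'" "\<And>j. j \<in> {1..k * m} \<Longrightarrow> \<exists>i\<in>{1..k}. P' j \<subseteq> P i" by blast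
    have "card V \<ge> n\<^sub>0" using large by simp
    with V P'(1) it[rule_format, of V P' E] obtain q W where q: "k * m \<le> q" "q \<le> M"
      and W: "equitable_partition V q W" "\<And>j. j \<in> {1..q} \<Longrightarrow> \<exists>i\<in>{1..k * m}. W j \<subseteq> P' i"
      and en: "uniform_partition \<delta> V E q W \<or>
        real t * (\<delta> ^ 5 / 8 * (real (card V))\<^sup>2) \<le> energy E (W ` {1..q}) (W ` {1..q})"
      by auto
    \<comment> \<open>Strictness needs a nonempty V, which the extra 1 in the bound on card V
      provides.\<close>
    have "1 * (real (card V))\<^sup>2 < (real t * (\<delta> ^ 5 / 8)) * (real (card V))\<^sup>2"
      using t large by (intro mult_strict_right_mono) auto
    then have "uniform_partition \<delta> V E q W"
      using en equitable_partition_energy_le[OF V W(1), of E] by (simp add: mult.assoc)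
    moreover have "\<exists>i\<in>{1..k}. W j \<subseteq> P i" if "j \<in> {1..q}" for j
      using W(2)[OF that] P'(2) by (meson order_trans)
    moreover have "k \<le> q" "l \<le> q" using km q by linarith+
    ultimately show ?thesis using q by blast
  qed
  then show ?thesis by blast
qed

section \<open>Nearly homogeneous refinements\<close>

text \<open>This predicate and the next one match the alternatives of the theorem literally, so its
  statement can be folded into them.\<close>

definition few_homogeneous :: "nat \<Rightarrow> real \<Rightarrow> 'a set set \<Rightarrow> 'a set \<Rightarrow> bool" where
  "few_homogeneous r \<xi> E U \<longleftrightarrow>
     real (num_cliques r U (induced_edges E U)) \<le> \<xi> * real (card U) ^ r \<or>
     real (num_cliques r U (complement_edges U (induced_edges E U))) \<le> \<xi> * real (card U) ^ r"

definition nearly_homogeneous :: "real \<Rightarrow> 'a set set \<Rightarrow> 'a set \<Rightarrow> bool" where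
  "nearly_homogeneous \<epsilon> E U \<longleftrightarrow>
     real (card (induced_edges E U)) < \<epsilon> * real (card U choose 2) \<or>
     real (card (induced_edges E U)) > (1 - \<epsilon>) * real (card U choose 2)"

lemma num_cliques_cong:
  assumes "\<And>x y. x \<in> U \<Longrightarrow> y \<in> U \<Longrightarrow> x \<noteq> y \<Longrightarrow> {x, y} \<in> E \<longleftrightarrow> {x, y} \<in> F"
  shows "num_cliques r U E = num_cliques r U F"
proof -
  have "clique C E \<longleftrightarrow> clique C F" if "C \<in> [U]\<^bsup>r\<^esup>" for C
    using that assms unfolding nsets_def clique_def by blast
  then have "{C \<in> [U]\<^bsup>r\<^esup>. clique C E} = {C \<in> [U]\<^bsup>r\<^esup>. clique C F}" by blast
  then show ?thesis by (simp add: num_cliques_def)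
qed

text \<open>Cliques of U see only the edges inside U, where the complements taken in U and in V
  agree. One global edge set and its complement therefore serve all parts at once.\<close>

lemma few_homogeneous_iff:
  assumes "U \<subseteq> V"
  shows "few_homogeneous r \<xi> E U \<longleftrightarrow>
     real (num_cliques r U E) \<le> \<xi> * real (card U) ^ r \<or>
     real (num_cliques r U (complement_edges V E)) \<le> \<xi> * real (card U) ^ r"
proof -
  have "num_cliques r U (induced_edges E U) = num_cliques r U E"
    by (rule num_cliques_cong) (auto simp: induced_edges_def)
  moreover have "num_cliques r U (complement_edges U (induced_edges E U))
      = num_cliques r U (complement_edges V E)"
    using assms by (intro num_cliques_cong)
      (auto simp: induced_edges_def complement_edges_def nsets_def)
  ultimately show ?thesis by (simp add: few_homogeneous_def)
qed

text \<open>Cliques of W are cliques of U, so only the change of normalisation costs anything: a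
  factor of at most \<open>c ^ r\<close>.\<close>

lemma few_homogeneous_subset:
  assumes "few_homogeneous r \<xi> E U" "W \<subseteq> U" "finite U" "real (card U) \<le> c * real (card W)"
    "\<xi> \<ge> 0" "\<xi> * c ^ r \<le> \<xi>'"
  shows "few_homogeneous r \<xi>' E W"
proof -
  have "\<xi> * real (card U) ^ r \<le> \<xi> * (c * real (card W)) ^ r"
    using assms by (intro mult_left_mono power_mono) auto
  also have "\<dots> = (\<xi> * c ^ r) * real (card W) ^ r" by (simp add: power_mult_distrib)
  also have "\<dots> \<le> \<xi>' * real (card W) ^ r" using assms by (intro mult_right_mono) auto
  finally have le: "\<xi> * real (card U) ^ r \<le> \<xi>' * real (card W) ^ r" .
  have mono: "real (num_cliques r W F) \<le> real (num_cliques r U F)" for F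
    using assms by (intro of_nat_mono num_cliques_mono)
  show ?thesis
    using assms(1) le mono[of E] mono[of "complement_edges U E"]
    unfolding few_homogeneous_iff[OF order_refl[of U]] few_homogeneous_iff[OF assms(2)]
    by (meson order_trans)
qed

section \<open>Edge counts of sparse and dense sets\<close>

lemma num_edges_between_self:
  assumes "finite W" "E \<subseteq> [V]\<^bsup>2\<^esup>"
  shows "num_edges_between E W W = 2 * card (induced_edges E W)"
proof -
  have two: "\<exists>a b. e = {a, b} \<and> a \<noteq> b \<and> a \<in> W \<and> b \<in> W" if "e \<in> induced_edges E W" for e
  proof -
    have "card e = 2" "e \<subseteq> W" using that assms by (auto simp: induced_edges_def nsets_def)
    then show ?thesis by (auto simp: card_2_iff)
  qed
  have card2: "card {(x, y). {x, y} = e} = 2 \<and> finite {(x, y). {x, y} = e}"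
    if e: "e \<in> induced_edges E W" for e
  proof -
    obtain a b where "e = {a, b}" "a \<noteq> b" using two[OF e] by blast
    then have "{(x, y). {x, y} = e} = {(a, b), (b, a)}" by (auto simp: doubleton_eq_iff)
    then show ?thesis using \<open>a \<noteq> b\<close> by simp
  qed
  have fin: "finite (induced_edges E W)"
    by (rule finite_subset[of _ "Pow W"]) (use assms in \<open>auto simp: induced_edges_def\<close>)
  have "{(x, y) \<in> W \<times> W. {x, y} \<in> E} = (\<Union>e\<in>induced_edges E W. {(x, y). {x, y} = e})"
    by (auto simp: induced_edges_def)
  then have "num_edges_between E W W = card (\<Union>e\<in>induced_edges E W. {(x, y). {x, y} = e})"
    by (simp add: num_edges_between_def)
  also have "\<dots> = (\<Sum>e\<in>induced_edges E W. card {(x, y). {x, y} = e})"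
    using fin card2 by (intro card_UN_disjoint) auto
  also have "\<dots> = (\<Sum>e\<in>induced_edges E W. 2)" using card2 by (intro sum.cong) auto
  finally show ?thesis by simp
qed

lemma card_induced_edges_complement:
  assumes "finite V" "E \<subseteq> [V]\<^bsup>2\<^esup>" "W \<subseteq> V"
  shows "card (induced_edges E W) + card (induced_edges (complement_edges V E) W) = card W choose 2"
proof -
  have fW: "finite W" using assms finite_subset by blast
  have "[W]\<^bsup>2\<^esup> = induced_edges E W \<union> induced_edges (complement_edges V E) W"
    using assms(2,3) by (auto simp: induced_edges_def complement_edges_def nsets_def)
  moreover have "induced_edges E W \<inter> induced_edges (complement_edges V E) W = {}"
    by (auto simp: induced_edges_def complement_edges_def)
  moreover have "finite ([W]\<^bsup>2\<^esup>)" using fW by (rule finite_imp_finite_nsets)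
  ultimately have "card ([W]\<^bsup>2\<^esup>)
      = card (induced_edges E W) + card (induced_edges (complement_edges V E) W)"
    by (metis card_Un_disjoint finite_Un)
  then show ?thesis by (simp add: card_nsets)
qed

text \<open>The slack factor 4 turns a bound against w^2 into a strict one against w * (w - 1): w /
  4 < w - 1 as soon as w \<ge> 2.\<close>

lemma card_induced_edges_less:
  fixes \<epsilon> :: real
  assumes "finite W" "E \<subseteq> [V]\<^bsup>2\<^esup>" "card W \<ge> 2" "\<epsilon> > 0"
    and "real (num_edges_between E W W) \<le> \<epsilon> / 4 * (real (card W))\<^sup>2"
  shows "real (card (induced_edges E W)) < \<epsilon> * real (card W choose 2)"
proof -
  define w where "w = card W"
  have "even (w * (w - 1))" by (cases w) auto
  then have "2 * (w choose 2) = w * (w - 1)" by (simp add: choose_two)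
  then have "real (2 * (w choose 2)) = real (w * (w - 1))" by (rule arg_cong)
  then have ch: "2 * real (w choose 2) = real w * (real w - 1)"
    using assms by (simp add: w_def of_nat_diff)
  have "2 * real (card (induced_edges E W)) \<le> \<epsilon> / 4 * (real w)\<^sup>2"
    using assms(5) num_edges_between_self[OF assms(1,2)] by (simp add: w_def)
  also have "\<dots> = (\<epsilon> * real w) * (real w / 4)" by (simp add: power2_eq_square)
  also have "\<dots> < (\<epsilon> * real w) * (real w - 1)"
    using assms by (intro mult_strict_left_mono) (auto simp: w_def)
  also have "\<dots> = 2 * (\<epsilon> * real (w choose 2))" using ch by simp
  finally show ?thesis by (simp add: w_def)
qed

text \<open>The sparse equipartition is applied to E or to its complement. Both alternatives yield
  the same m, so parts of different kinds can be subdivided together without losing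
  equitability.\<close>

lemma nearly_homogeneous_equipartition:
  fixes \<epsilon> :: real
  assumes \<epsilon>: "\<epsilon> > 0"
  shows "\<exists>\<xi>>0. \<exists>m\<ge>1. \<exists>n\<^sub>0. \<forall>(V :: 'a set) E U. simple_graph V E \<longrightarrow> U \<subseteq> V \<longrightarrow> card U \<ge> n\<^sub>0 \<longrightarrow>
    few_homogeneous (Suc r) \<xi> E U \<longrightarrow>
    (\<exists>W. disjoint_family_on W {..<m} \<and> (\<forall>a<m. W a \<subseteq> U \<and> card (W a) = card U div m \<and>
       nearly_homogeneous \<epsilon> E (W a)))"
proof -
  have "\<epsilon> / 4 > 0" using \<epsilon> by simp
  from sparse_equipartition_of_few_cliques[OF this, of r] obtain \<xi> m n\<^sub>0 where
    \<xi>: "\<xi> > 0" and m: "m \<ge> 1" and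
    sp: "\<forall>(U :: 'a set) E. finite U \<longrightarrow> (\<forall>x. {x} \<notin> E) \<longrightarrow> card U \<ge> n\<^sub>0 \<longrightarrow>
    real (num_cliques (Suc r) U E) \<le> \<xi> * real (card U) ^ Suc r \<longrightarrow>
    (\<exists>W. disjoint_family_on W {..<m} \<and> (\<forall>a<m. W a \<subseteq> U \<and> card (W a) = card U div m \<and>
       real (num_edges_between E (W a) (W a)) \<le> \<epsilon> / 4 * (real (card (W a)))\<^sup>2))"
    by (elim exE conjE) (rule that)
  have "\<exists>W. disjoint_family_on W {..<m} \<and> (\<forall>a<m. W a \<subseteq> U \<and> card (W a) = card U div m \<and>
       nearly_homogeneous \<epsilon> E (W a))"
    if G: "simple_graph V E" and U: "U \<subseteq> V" and large: "card U \<ge> n\<^sub>0 + 2 * m"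
      and few: "few_homogeneous (Suc r) \<xi> E U" for V :: "'a set" and E U
  proof -
    have V: "finite V" and E: "E \<subseteq> [V]\<^bsup>2\<^esup>" using G by (auto simp: simple_graph_def)
    have fU: "finite U" using U V finite_subset by blast
    have E': "complement_edges V E \<subseteq> [V]\<^bsup>2\<^esup>" by (auto simp: complement_edges_def)
    \<comment> \<open>Parts with fewer than two vertices have binomial coefficient 0, and both
      strict inequalities would fail.\<close>
    have two: "card U div m \<ge> 2"
    proof -
      have "2 * m div m \<le> card U div m" using large by (intro div_le_mono) simp
      then show ?thesis using m by simp
    qed
    have key: "\<exists>W. disjoint_family_on W {..<m} \<and> (\<forall>a<m. W a \<subseteq> U \<and> card (W a) = card U div m \<and>
       real (card (induced_edges F (W a))) < \<epsilon> * real (card (W a) choose 2))"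
      if F: "F \<subseteq> [V]\<^bsup>2\<^esup>" and fewF: "real (num_cliques (Suc r) U F) \<le> \<xi> * real (card U) ^ Suc r"
      for F
    proof -
      have loops: "\<forall>x. {x} \<notin> F" using F by (auto simp: nsets_def)
      have "card U \<ge> n\<^sub>0" using large by simp
      from sp[rule_format, OF fU _ this fewF] loops obtain W where W: "disjoint_family_on W {..<m}"
        "\<And>a. a < m \<Longrightarrow> W a \<subseteq> U \<and> card (W a) = card U div m \<and>
          real (num_edges_between F (W a) (W a)) \<le> \<epsilon> / 4 * (real (card (W a)))\<^sup>2" by blast
      have "real (card (induced_edges F (W a))) < \<epsilon> * real (card (W a) choose 2)" if "a < m" for a
      proof (rule card_induced_edges_less[OF _ F])
        show "finite (W a)" using W(2)[OF that] fU finite_subset by blast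
        show "card (W a) \<ge> 2" using W(2)[OF that] two by simp
      qed (use W(2)[OF that] \<epsilon> in auto)
      then show ?thesis using W by blast
    qed
    from few consider "real (num_cliques (Suc r) U E) \<le> \<xi> * real (card U) ^ Suc r"
      | "real (num_cliques (Suc r) U (complement_edges V E)) \<le> \<xi> * real (card U) ^ Suc r"
      unfolding few_homogeneous_iff[OF U] by blast
    then show ?thesis
    proof cases
      case 1
      from key[OF E this] show ?thesis unfolding nearly_homogeneous_def by blast
    next
      case 2
      from key[OF E' this] obtain W where W: "disjoint_family_on W {..<m}"
        "\<And>a. a < m \<Longrightarrow> W a \<subseteq> U \<and> card (W a) = card U div m \<and>
          real (card (induced_edges (complement_edges V E) (W a))) < \<epsilon> * real (card (W a) choose 2)"
        by blast
      have "nearly_homogeneous \<epsilon> E (W a)" if "a < m" for a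
      proof -
        have "W a \<subseteq> V" using W(2)[OF that] U by blast
        then have "real (card (induced_edges E (W a)))
            + real (card (induced_edges (complement_edges V E) (W a))) = real (card (W a) choose 2)"
          using card_induced_edges_complement[OF V E] by (metis of_nat_add)
        then have "real (card (induced_edges E (W a))) > (1 - \<epsilon>) * real (card (W a) choose 2)"
          using W(2)[OF that] unfolding left_diff_distrib by linarith
        then show ?thesis by (simp add: nearly_homogeneous_def)
      qed
      then show ?thesis using W by blast
    qed
  qed
  then show ?thesis using \<xi> m by blast
qed

text \<open>Test sets that are large in A' and B' are large in A and B, and so are A' and B'
  themselves because \<epsilon> \<le> 1. Both densities are thus within \<delta> of that of (A, B),
  hence within 2 * \<delta> \<le> \<epsilon> of each other.\<close>

lemma uniform_pair_subset:
  fixes \<epsilon> \<delta> :: real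
  assumes u: "uniform_pair \<delta> E A B" and sub: "A' \<subseteq> A" "B' \<subseteq> B"
    and le: "\<delta> * real (card A) \<le> \<epsilon> * real (card A')" "\<delta> * real (card B) \<le> \<epsilon> * real (card B')"
    and \<epsilon>: "\<epsilon> \<le> 1" "2 * \<delta> \<le> \<epsilon>"
  shows "uniform_pair \<epsilon> E A' B'"
  unfolding uniform_pair_def
proof (intro allI impI)
  fix X Y
  assume XY: "X \<subseteq> A' \<and> Y \<subseteq> B' \<and> \<epsilon> * real (card A') \<le> real (card X) \<and>
    \<epsilon> * real (card B') \<le> real (card Y)"
  have close: "\<bar>edge_density E C D - edge_density E A B\<bar> < \<delta>"
    if "C \<subseteq> A" "D \<subseteq> B" "\<delta> * real (card A) \<le> real (card C)" "\<delta> * real (card B) \<le> real (card D)" for C D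
    using u that unfolding uniform_pair_def by blast
  have "\<bar>edge_density E X Y - edge_density E A B\<bar> < \<delta>"
    using XY sub le by (intro close) auto
  moreover have "\<epsilon> * real (card A') \<le> 1 * real (card A')" "\<epsilon> * real (card B') \<le> 1 * real (card B')"
    using \<epsilon> by (intro mult_right_mono; simp)+
  then have "\<bar>edge_density E A' B' - edge_density E A B\<bar> < \<delta>"
    using sub le by (intro close) auto
  ultimately show "\<bar>edge_density E X Y - edge_density E A' B'\<bar> < \<epsilon>" using \<epsilon> by linarith
qed

text \<open>The case of many parts. Here \<delta> and \<xi> are fixed before k, which is possible
  because every part is cut into the same m pieces whatever k is; L is simply k * m.\<close>

lemma nearly_homogeneous_refinement:
  fixes \<epsilon> :: real
  assumes \<epsilon>: "\<epsilon> > 0" "\<epsilon> \<le> 1"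
  shows "\<exists>\<delta>>0. \<exists>\<xi>>0. \<forall>k. 2 / \<epsilon> \<le> real k \<longrightarrow> (\<exists>L n\<^sub>0. \<forall>(V :: 'a set) E P.
    simple_graph V E \<and> card V \<ge> n\<^sub>0 \<and> uniform_partition \<delta> V E k P \<and>
    (\<forall>i\<in>{1..k}. few_homogeneous (Suc r) \<xi> E (P i)) \<longrightarrow>
    (\<exists>q W. k \<le> q \<and> q \<le> L \<and> uniform_partition \<epsilon> V E q W \<and>
       (\<forall>i\<in>{1..q}. nearly_homogeneous \<epsilon> E (W i))))"
proof -
  from nearly_homogeneous_equipartition[OF \<epsilon>(1), of r] obtain \<xi> m n\<^sub>1 where
    \<xi>: "\<xi> > 0" and m: "m \<ge> 1" and
    hom: "\<forall>(V :: 'a set) E U. simple_graph V E \<longrightarrow> U \<subseteq> V \<longrightarrow> card U \<ge> n\<^sub>1 \<longrightarrow>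
      few_homogeneous (Suc r) \<xi> E U \<longrightarrow>
      (\<exists>W. disjoint_family_on W {..<m} \<and> (\<forall>a<m. W a \<subseteq> U \<and> card (W a) = card U div m \<and>
       nearly_homogeneous \<epsilon> E (W a)))"
    by (elim exE conjE) (rule that)
  \<comment> \<open>A piece keeps at least 1 / (2 * m) of its part, so an \<epsilon> fraction of the
    piece is at least a \<delta> fraction of the part.\<close>
  define \<delta> where "\<delta> = \<epsilon> / (2 * real m)"
  have \<delta>: "\<delta> > 0" "2 * \<delta> \<le> \<epsilon>" using \<epsilon> m by (auto simp: \<delta>_def field_simps)
  have "\<exists>q W. k \<le> q \<and> q \<le> k * m \<and> uniform_partition \<epsilon> V E q W \<and>
       (\<forall>i\<in>{1..q}. nearly_homogeneous \<epsilon> E (W i))"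
    if k: "2 / \<epsilon> \<le> real k" and G: "simple_graph V E" and large: "card V \<ge> k * (n\<^sub>1 + m + 1)"
      and up: "uniform_partition \<delta> V E k P" and few: "\<forall>i\<in>{1..k}. few_homogeneous (Suc r) \<xi> E (P i)"
    for k and V :: "'a set" and E P
  proof -
    have V: "finite V" using G by (simp add: simple_graph_def)
    have "2 / \<epsilon> > 0" using \<epsilon> by simp
    with k have k1: "k \<ge> 1" by linarith
    have k2: "2 \<le> \<epsilon> * real k" using k \<epsilon> by (simp add: field_simps)
    have P: "equitable_partition V k P" using up by (simp add: uniform_partition_def)
    define N where "N = card (P 1)"
    have I1: "1 \<in> {1..k}" using k1 by simp
    have cP: "card (P i) = N" if "i \<in> {1..k}" for i
      using P that I1 unfolding equitable_partition_def N_def by blast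
    have cV: "card V = card (P 0) + k * N"
      using equitable_partition_card[OF V P I1] by (simp add: N_def)
    have P0: "card (P 0) < k" using P by (simp only: equitable_partition_def)
    have PV: "P i \<subseteq> V" if "i \<in> {1..k}" for i
      using P that unfolding equitable_partition_def by fastforce
    have "k * (n\<^sub>1 + m + 1) < k + k * N" using large cV P0 by linarith
    also have "k + k * N = k * (N + 1)" by simp
    finally have "n\<^sub>1 + m + 1 < N + 1" by (simp only: mult_less_cancel1)
    then have N: "n\<^sub>1 + m < N" by simp
    have "\<forall>i\<in>{1..k}. \<exists>W. disjoint_family_on W {..<m} \<and>
      (\<forall>a<m. W a \<subseteq> P i \<and> card (W a) = card (P i) div m \<and> nearly_homogeneous \<epsilon> E (W a))"
    proof
      fix i assume i: "i \<in> {1..k}"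
      have "card (P i) \<ge> n\<^sub>1" using cP[OF i] N by simp
      then show "\<exists>W. disjoint_family_on W {..<m} \<and>
        (\<forall>a<m. W a \<subseteq> P i \<and> card (W a) = card (P i) div m \<and> nearly_homogeneous \<epsilon> E (W a))"
        using few i by (intro hom[rule_format, OF G PV[OF i]]) auto
    qed
    then obtain h where h: "\<forall>i\<in>{1..k}. disjoint_family_on (h i) {..<m} \<and>
      (\<forall>a<m. h i a \<subseteq> P i \<and> card (h i a) = card (P i) div m \<and> nearly_homogeneous \<epsilon> E (h i a))"
      by metis
    define W where "W = subdivision V k m h"
    have W: "equitable_partition V (k * m) W"
      unfolding W_def using h by (intro equitable_partition_subdivision[OF V P k1] m) blast+
    define b where "b = (\<lambda>j. (j - 1) div m + 1)"
    have b: "b j \<in> {1..k}" "W j \<subseteq> P (b j)" "card (W j) = N div m" "nearly_homogeneous \<epsilon> E (W j)"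
      if j: "j \<in> {1..k * m}" for j
    proof -
      show bj: "b j \<in> {1..k}" using subdivision_index(1)[OF j] by (simp add: b_def)
      have "W j = h (b j) ((j - 1) mod m)" using j by (simp add: W_def subdivision_def b_def)
      then show "W j \<subseteq> P (b j)" "card (W j) = N div m" "nearly_homogeneous \<epsilon> E (W j)"
        using h bj subdivision_index(2)[OF j] cP[OF bj] by auto
    qed
    \<comment> \<open>Since N \<ge> m, the remainder of N modulo m is less than m * (N div m), so
      rounding costs at most a factor 2.\<close>
    have dN: "\<delta> * real N \<le> \<epsilon> * real (N div m)"
    proof -
      have "m div m \<le> N div m" using N by (intro div_le_mono) simp
      then have 1: "1 \<le> N div m" using m by simp
      have "N = m * (N div m) + N mod m" "N mod m < m" using m by simp_all
      moreover have "m * 1 \<le> m * (N div m)" using 1 by (rule mult_le_mono2)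
      ultimately have "N \<le> 2 * m * (N div m)" by linarith
      then have "real N \<le> real (2 * m * (N div m))" by (rule of_nat_mono)
      then have "\<delta> * real N \<le> \<delta> * (2 * real m * real (N div m))"
        using \<delta> by (intro mult_left_mono) auto
      also have "\<dots> = \<epsilon> * real (N div m)" using m by (simp add: \<delta>_def)
      finally show ?thesis .
    qed
    define bad where "bad = {(i, j). 1 \<le> i \<and> i < j \<and> j \<le> k \<and> \<not> uniform_pair \<delta> E (P i) (P j)}"
    define bad' where "bad' = {(i, j). 1 \<le> i \<and> i < j \<and> j \<le> k * m \<and> \<not> uniform_pair \<epsilon> E (W i) (W j)}"
    \<comment> \<open>The possible positions of a non-uniform pair of pieces: inside one part,
      recorded on the diagonal, or in a non-uniform pair of parts. Each position accounts for at
      most m * m pairs of pieces.\<close>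
    define D where "D = (\<lambda>i. (i, i)) ` {1..k} \<union> bad"
    define f where "f = (\<lambda>(p, a, c). ((fst p - 1) * m + a + 1, (snd p - 1) * m + c + 1))"
    have finbad: "finite bad" by (rule finite_subset[of _ "{1..k} \<times> {1..k}"]) (auto simp: bad_def)
    have "bad' \<subseteq> f ` (D \<times> {..<m} \<times> {..<m})"
    proof
      fix p assume "p \<in> bad'"
      then obtain i j where p: "p = (i, j)" and ij: "1 \<le> i" "i < j" "j \<le> k * m"
        and nu: "\<not> uniform_pair \<epsilon> E (W i) (W j)" by (auto simp: bad'_def)
      have i: "i \<in> {1..k * m}" and j: "j \<in> {1..k * m}" using ij by auto
      have "b i \<le> b j" unfolding b_def using ij by (simp add: div_le_mono)
      have "(b i, b j) \<in> D"
      proof (cases "b i = b j")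
        case True
        then show ?thesis using b(1)[OF i] by (auto simp: D_def)
      next
        case False
        have "\<not> uniform_pair \<delta> E (P (b i)) (P (b j))"
        proof
          assume "uniform_pair \<delta> E (P (b i)) (P (b j))"
          then have "uniform_pair \<epsilon> E (W i) (W j)"
            by (rule uniform_pair_subset[OF _ b(2)[OF i] b(2)[OF j] _ _ \<epsilon>(2) \<delta>(2)])
               (simp_all only: cP[OF b(1)[OF i]] cP[OF b(1)[OF j]] b(3)[OF i] b(3)[OF j] dN)
          with nu show False ..
        qed
        then have "(b i, b j) \<in> bad"
          using False \<open>b i \<le> b j\<close> b(1)[OF i] b(1)[OF j] by (auto simp: bad_def)
        then show ?thesis by (simp add: D_def)
      qed
      moreover have "p = f ((b i, b j), (i - 1) mod m, (j - 1) mod m)"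
        using p ij by (simp add: f_def b_def)
      moreover have "(i - 1) mod m < m" "(j - 1) mod m < m" using m by auto
      ultimately show "p \<in> f ` (D \<times> {..<m} \<times> {..<m})" by blast
    qed
    then have "card bad' \<le> card (f ` (D \<times> {..<m} \<times> {..<m}))"
      using finbad by (intro card_mono) (auto simp: D_def)
    also have "\<dots> \<le> card (D \<times> {..<m} \<times> {..<m})"
      using finbad by (intro card_image_le) (auto simp: D_def)
    also have "\<dots> = card D * (m * m)" by (simp add: card_cartesian_product)
    finally have "real (card bad') \<le> real (card D * (m * m))" by (rule of_nat_mono)
    also have "\<dots> = real (card D) * (real m)\<^sup>2" by (simp add: power2_eq_square)
    also have "\<dots> \<le> (\<epsilon> * (real k)\<^sup>2) * (real m)\<^sup>2"
    proof (rule mult_right_mono)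
      \<comment> \<open>The diagonal contributes k \<le> \<epsilon>/2 * k^2 because k \<ge> 2 /
        \<epsilon>, and the non-uniform pairs at most \<delta> * k^2 \<le> \<epsilon>/2 *
        k^2.\<close>
      have "card D \<le> card ((\<lambda>i. (i, i)) ` {1..k}) + card bad" unfolding D_def by (rule card_Un_le)
      also have "\<dots> \<le> k + card bad" using card_image_le[of "{1..k}" "\<lambda>i. (i, i)"] by simp
      finally have "real (card D) \<le> real k + real (card bad)" by linarith
      moreover have "real (card bad) \<le> \<delta> * (real k)\<^sup>2"
        using up by (simp add: uniform_partition_def bad_def)
      moreover have "\<delta> * (real k)\<^sup>2 \<le> \<epsilon> / 2 * (real k)\<^sup>2" using \<delta> by (intro mult_right_mono) auto
      moreover have "2 * real k \<le> \<epsilon> * real k * real k" using k2 by (intro mult_right_mono) auto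
      ultimately show "real (card D) \<le> \<epsilon> * (real k)\<^sup>2" by (simp add: power2_eq_square)
    qed simp
    also have "\<dots> = \<epsilon> * (real (k * m))\<^sup>2" by (simp add: power_mult_distrib)
    finally have "uniform_partition \<epsilon> V E (k * m) W"
      using W by (simp add: uniform_partition_def bad'_def)
    moreover have "k * 1 \<le> k * m" using m by (rule mult_le_mono2)
    ultimately show ?thesis using b(4) by (intro exI[of _ "k * m"] exI[of _ W]) auto
  qed
  then show ?thesis using \<delta>(1) \<xi> by blast
qed

section \<open>Monotonicity in \<epsilon> and the distinction between few and many parts\<close>

lemma uniform_partition_mono:
  fixes \<delta> \<epsilon> :: real
  assumes "uniform_partition \<delta> V E k P" "\<delta> \<le> \<epsilon>"
  shows "uniform_partition \<epsilon> V E k P"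
proof -
  have up: "uniform_pair \<epsilon> E A B" if u: "uniform_pair \<delta> E A B" for A B
    unfolding uniform_pair_def
  proof (intro allI impI)
    fix X Y assume XY: "X \<subseteq> A \<and> Y \<subseteq> B \<and> \<epsilon> * real (card A) \<le> real (card X) \<and>
      \<epsilon> * real (card B) \<le> real (card Y)"
    have "\<delta> * real (card A) \<le> \<epsilon> * real (card A)" "\<delta> * real (card B) \<le> \<epsilon> * real (card B)"
      using assms(2) by (intro mult_right_mono; simp)+
    then have "\<bar>edge_density E X Y - edge_density E A B\<bar> < \<delta>"
      using u XY unfolding uniform_pair_def by force
    then show "\<bar>edge_density E X Y - edge_density E A B\<bar> < \<epsilon>" using assms(2) by simp
  qed
  have "card {(i, j). 1 \<le> i \<and> i < j \<and> j \<le> k \<and> \<not> uniform_pair \<epsilon> E (P i) (P j)}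
    \<le> card {(i, j). 1 \<le> i \<and> i < j \<and> j \<le> k \<and> \<not> uniform_pair \<delta> E (P i) (P j)}"
  proof (rule card_mono)
    show "finite {(i, j). 1 \<le> i \<and> i < j \<and> j \<le> k \<and> \<not> uniform_pair \<delta> E (P i) (P j)}"
      by (rule finite_subset[of _ "{1..k} \<times> {1..k}"]) auto
  qed (use up in blast)
  moreover have "\<delta> * (real k)\<^sup>2 \<le> \<epsilon> * (real k)\<^sup>2" using assms(2) by (intro mult_right_mono) auto
  ultimately show ?thesis using assms(1) unfolding uniform_partition_def by linarith
qed

lemma nearly_homogeneous_mono:
  assumes "nearly_homogeneous \<delta> E U" "\<delta> \<le> \<epsilon>"
  shows "nearly_homogeneous \<epsilon> E U"
proof -
  have "\<delta> * real (card U choose 2) \<le> \<epsilon> * real (card U choose 2)"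
    using assms(2) by (intro mult_right_mono) auto
  then show ?thesis using assms(1) unfolding nearly_homogeneous_def by (auto simp: algebra_simps)
qed

theorem theorem6:
  fixes \<epsilon> :: real and r :: nat
  assumes "\<epsilon> > 0" and "r \<ge> 2"
  shows "\<exists>\<delta>>0. \<exists>\<xi>>0. \<forall>k\<ge>2. \<exists>L n\<^sub>0. \<forall>(V :: 'a set) E P.
    simple_graph V E \<and> card V \<ge> n\<^sub>0 \<and> uniform_partition \<delta> V E k P \<and>
    (\<forall>i\<in>{1..k}.
       real (num_cliques r (P i) (induced_edges E (P i))) \<le> \<xi> * real (card (P i)) ^ r \<or>
       real (num_cliques r (P i) (complement_edges (P i) (induced_edges E (P i))))
         \<le> \<xi> * real (card (P i)) ^ r)
    \<longrightarrow>
    (\<exists>q W. k \<le> q \<and> q \<le> L \<and> uniform_partition \<epsilon> V E q W \<and>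
       (\<forall>i\<in>{1..q}.
          real (card (induced_edges E (W i))) < \<epsilon> * real (card (W i) choose 2) \<or>
          real (card (induced_edges E (W i))) > (1 - \<epsilon>) * real (card (W i) choose 2)))"
  unfolding few_homogeneous_def[symmetric] nearly_homogeneous_def[symmetric]
proof -
  \<comment> \<open>Inheritance of uniformity needs \<epsilon> \<le> 1; since both conclusions are
    monotone in \<epsilon>, a smaller value may be used.\<close>
  define \<epsilon>' where "\<epsilon>' = min \<epsilon> 1"
  have \<epsilon>': "\<epsilon>' > 0" "\<epsilon>' \<le> 1" "\<epsilon>' \<le> \<epsilon>" using assms by (auto simp: \<epsilon>'_def)
  obtain r' where r': "r = Suc r'" using assms(2) by (cases r) auto
  from nearly_homogeneous_refinement[OF \<epsilon>'(1,2), of r'] obtain \<delta> \<xi> where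
    \<delta>: "\<delta> > 0" and \<xi>: "\<xi> > 0" and *: "\<forall>k. 2 / \<epsilon>' \<le> real k \<longrightarrow> (\<exists>L n\<^sub>0. \<forall>(V :: 'a set) E P.
    simple_graph V E \<and> card V \<ge> n\<^sub>0 \<and> uniform_partition \<delta> V E k P \<and>
    (\<forall>i\<in>{1..k}. few_homogeneous r \<xi> E (P i)) \<longrightarrow>
    (\<exists>q W. k \<le> q \<and> q \<le> L \<and> uniform_partition \<epsilon>' V E q W \<and>
       (\<forall>i\<in>{1..q}. nearly_homogeneous \<epsilon>' E (W i))))"
    unfolding r'[symmetric] by (elim exE conjE) (rule that)
  \<comment> \<open>As with \<open>Reg\<close> below, the name keeps the quantification over graphs
    closed while the bounds are chosen as functions of k.\<close>
  define Many where "Many k L n \<longleftrightarrow> (\<forall>(V :: 'a set) E P.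
    simple_graph V E \<and> card V \<ge> n \<and> uniform_partition \<delta> V E k P \<and>
    (\<forall>i\<in>{1..k}. few_homogeneous r \<xi> E (P i)) \<longrightarrow>
    (\<exists>q W. k \<le> q \<and> q \<le> L \<and> uniform_partition \<epsilon>' V E q W \<and>
       (\<forall>i\<in>{1..q}. nearly_homogeneous \<epsilon>' E (W i))))" for k L n
  from *[folded Many_def] obtain L n\<^sub>0 where
    Many: "\<And>k. 2 / \<epsilon>' \<le> real k \<Longrightarrow> Many k (L k) (n\<^sub>0 k)" by metis
  have many: "\<exists>q W. k \<le> q \<and> q \<le> L k \<and> uniform_partition \<epsilon>' V E q W \<and>
       (\<forall>i\<in>{1..q}. nearly_homogeneous \<epsilon>' E (W i))"
    if "2 / \<epsilon>' \<le> real k" "simple_graph V E" "card V \<ge> n\<^sub>0 k" "uniform_partition \<delta> V E k P"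
      "\<forall>i\<in>{1..k}. few_homogeneous r \<xi> E (P i)" for k and V :: "'a set" and E P
    using Many[OF that(1), unfolded Many_def, rule_format, of V E P] that by simp
  define K where "K = nat \<lceil>2 / \<epsilon>'\<rceil>"
  have K: "2 / \<epsilon>' \<le> real k" if "K \<le> k" for k using that unfolding K_def by linarith
  define Reg where "Reg k M n \<longleftrightarrow> (\<forall>(V :: 'a set) E P.
    finite V \<and> card V \<ge> n \<and> equitable_partition V k P \<longrightarrow>
    (\<exists>q W. k \<le> q \<and> K \<le> q \<and> q \<le> M \<and> uniform_partition \<delta> V E q W \<and>
       (\<forall>j\<in>{1..q}. \<exists>i\<in>{1..k}. W j \<subseteq> P i)))" for k M n
  have "\<forall>k\<ge>1. \<exists>M n. Reg k M n"
    unfolding Reg_def by (intro allI impI szemeredi_regularity_refining[OF \<delta>])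
  then obtain M n\<^sub>1 where Reg: "\<And>k. k \<ge> 1 \<Longrightarrow> Reg k (M k) (n\<^sub>1 k)" by metis
  have reg: "\<exists>q W. k \<le> q \<and> K \<le> q \<and> q \<le> M k \<and> uniform_partition \<delta> V E q W \<and>
       (\<forall>j\<in>{1..q}. \<exists>i\<in>{1..k}. W j \<subseteq> P i)"
    if "k \<ge> 1" "finite V" "card V \<ge> n\<^sub>1 k" "equitable_partition V k P"
    for k and V :: "'a set" and E P
    using Reg[OF that(1), unfolded Reg_def, rule_format, of V P E] that by simp
  \<comment> \<open>Bounds the number of parts after regularisation simultaneously for all k < K;
    this makes \<open>\<xi>'\<close> independent of k.\<close>
  define m where "m = 1 + (\<Sum>k<K. M k)"
  \<comment> \<open>A refined part has at least card V / (2 * m) vertices while the part containing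
    it has at most card V, so the relative clique count grows by at most
    \<open>(2 * m) ^ r\<close>.\<close>
  define \<xi>' where "\<xi>' = \<xi> / (2 * real m) ^ r"
  have m1: "m \<ge> 1" by (simp add: m_def)
  then have m2: "1 \<le> (2 * real m) ^ r" by (intro one_le_power) simp
  have \<xi>': "\<xi>' > 0" "\<xi>' * (2 * real m) ^ r \<le> \<xi>" using \<xi> m1 by (auto simp: \<xi>'_def)
  have "\<xi>' * 1 \<le> \<xi>' * (2 * real m) ^ r" using m2 \<xi>' by (intro mult_left_mono) auto
  then have \<xi>'2: "\<xi>' \<le> \<xi>" using \<xi>' by linarith
  have "\<exists>L n\<^sub>0. \<forall>(V :: 'a set) E P. simple_graph V E \<and> card V \<ge> n\<^sub>0 \<and> uniform_partition \<delta> V E k P \<and>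
      (\<forall>i\<in>{1..k}. few_homogeneous r \<xi>' E (P i)) \<longrightarrow>
      (\<exists>q W. k \<le> q \<and> q \<le> L \<and> uniform_partition \<epsilon> V E q W \<and>
         (\<forall>i\<in>{1..q}. nearly_homogeneous \<epsilon> E (W i)))" if k: "k \<ge> 2" for k
  proof (cases "K \<le> k")
    case True
    have "\<exists>q W. k \<le> q \<and> q \<le> L k \<and> uniform_partition \<epsilon> V E q W \<and>
         (\<forall>i\<in>{1..q}. nearly_homogeneous \<epsilon> E (W i))"
      if G: "simple_graph V E" and large: "card V \<ge> n\<^sub>0 k" and up: "uniform_partition \<delta> V E k P"
        and few: "\<forall>i\<in>{1..k}. few_homogeneous r \<xi>' E (P i)" for V :: "'a set" and E P
    proof -
      have "few_homogeneous r \<xi> E (P i)" if "i \<in> {1..k}" for i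
      proof (rule few_homogeneous_subset[where c = 1 and U = "P i" and \<xi> = \<xi>'])
        have "finite V" using G by (simp add: simple_graph_def)
        moreover have "P i \<subseteq> V"
          using up that unfolding uniform_partition_def equitable_partition_def by fastforce
        ultimately show "finite (P i)" by (rule finite_subset[rotated])
      qed (use few that \<xi>' \<xi>'2 in auto)
      with many[OF K[OF True] G large up] obtain q W where
        "k \<le> q" "q \<le> L k" "uniform_partition \<epsilon>' V E q W"
        "\<forall>i\<in>{1..q}. nearly_homogeneous \<epsilon>' E (W i)" by blast
      then show ?thesis
        using uniform_partition_mono[OF _ \<epsilon>'(3)] nearly_homogeneous_mono[OF _ \<epsilon>'(3)] by blast
    qed
    then show ?thesis by blast
  next
    case False
    \<comment> \<open>Regularisation produces some q \<le> M k that depends on the graph, so the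
      bounds for all these q are added up.\<close>
    define L' where "L' = (\<Sum>q\<le>M k. L q)"
    define n\<^sub>0' where "n\<^sub>0' = n\<^sub>1 k + (\<Sum>q\<le>M k. n\<^sub>0 q) + 2 * m"
    have "M k \<le> (\<Sum>k<K. M k)" using False by (intro member_le_sum) auto
    then have Mm: "M k \<le> m" by (simp add: m_def)
    have "\<exists>q W. k \<le> q \<and> q \<le> L' \<and> uniform_partition \<epsilon> V E q W \<and>
         (\<forall>i\<in>{1..q}. nearly_homogeneous \<epsilon> E (W i))"
      if G: "simple_graph V E" and large: "card V \<ge> n\<^sub>0'" and up: "uniform_partition \<delta> V E k P"
        and few: "\<forall>i\<in>{1..k}. few_homogeneous r \<xi>' E (P i)" for V :: "'a set" and E P
    proof -
      have V: "finite V" using G by (simp add: simple_graph_def)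
      have P: "equitable_partition V k P" using up by (simp add: uniform_partition_def)
      have "k \<ge> 1" "card V \<ge> n\<^sub>1 k" using k large by (auto simp: n\<^sub>0'_def)
      from reg[OF this(1) V this(2) P, of E] obtain q W where q: "k \<le> q" "K \<le> q" "q \<le> M k"
        and W: "uniform_partition \<delta> V E q W" "\<And>j. j \<in> {1..q} \<Longrightarrow> \<exists>i\<in>{1..k}. W j \<subseteq> P i" by blast
      have eqW: "equitable_partition V q W" using W(1) by (simp add: uniform_partition_def)
      have "few_homogeneous r \<xi> E (W j)" if j: "j \<in> {1..q}" for j
      proof -
        obtain i where i: "i \<in> {1..k}" "W j \<subseteq> P i" using W(2)[OF j] by blast
        have PV: "P i \<subseteq> V" using P i(1) unfolding equitable_partition_def by fastforce
        have W0: "card (W 0) < q" using eqW by (simp only: equitable_partition_def)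
        have cV: "card V = card (W 0) + q * card (W j)"
          by (rule equitable_partition_card[OF V eqW j])
        \<comment> \<open>The term 2 * m in the order bound keeps the refined parts nonempty. Then
          the exceptional part, with fewer than q vertices, makes up at most half of V.\<close>
        have "2 * q \<le> card V" using large q Mm by (simp add: n\<^sub>0'_def)
        then have "card (W j) \<noteq> 0" using cV W0 by (intro notI) simp
        then have "q * 1 \<le> q * card (W j)" by (intro mult_le_mono2) simp
        then have "card V \<le> 2 * (q * card (W j))" using cV W0 by linarith
        also have "\<dots> \<le> 2 * (m * card (W j))" using q Mm by simp
        finally have "card (P i) \<le> 2 * (m * card (W j))"
          using card_mono[OF V PV] by linarith
        then have "real (card (P i)) \<le> real (2 * (m * card (W j)))" by (rule of_nat_mono)
        then have "real (card (P i)) \<le> 2 * real m * real (card (W j))" by simp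
        moreover have "finite (P i)" using PV V by (rule finite_subset)
        ultimately show ?thesis
          using few i \<xi>' by (intro few_homogeneous_subset[OF _ i(2)]) auto
      qed
      moreover have "n\<^sub>0 q \<le> (\<Sum>q\<le>M k. n\<^sub>0 q)" using q by (intro member_le_sum) auto
      then have "card V \<ge> n\<^sub>0 q" using large by (simp add: n\<^sub>0'_def)
      ultimately obtain q' W' where q': "q \<le> q'" "q' \<le> L q" "uniform_partition \<epsilon>' V E q' W'"
        "\<forall>i\<in>{1..q'}. nearly_homogeneous \<epsilon>' E (W' i)"
        using many[OF K[OF q(2)] G _ W(1)] by blast
      have "L q \<le> L'" unfolding L'_def using q by (intro member_le_sum) auto
      with q q' have "k \<le> q'" "q' \<le> L'" by auto
      with q' show ?thesis
        using uniform_partition_mono[OF _ \<epsilon>'(3)] nearly_homogeneous_mono[OF _ \<epsilon>'(3)] by blast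
    qed
    then show ?thesis by blast
  qed
  then show "\<exists>\<delta>>0. \<exists>\<xi>>0. \<forall>k\<ge>2. \<exists>L n\<^sub>0. \<forall>(V :: 'a set) E P.
    simple_graph V E \<and> card V \<ge> n\<^sub>0 \<and> uniform_partition \<delta> V E k P \<and>
    (\<forall>i\<in>{1..k}. few_homogeneous r \<xi> E (P i)) \<longrightarrow>
    (\<exists>q W. k \<le> q \<and> q \<le> L \<and> uniform_partition \<epsilon> V E q W \<and>
       (\<forall>i\<in>{1..q}. nearly_homogeneous \<epsilon> E (W i)))"
    using \<delta> \<xi>'(1) by blast
qed

end
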